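(* Let $\delta\in(0,1)$, let $f:\mathcal X\to\mathbb R^d$ have $\ell_2$-sensitivity $\Delta_2>0$ (i.e. $\|f(x)-f(x')\|_2\le\Delta_2$ for all $x\sim x'$), let $(T_n)_{n\ge1}$ be a sequence of time functions, and let $\mathrm{BM}$ be the Brownian mechanism associated with $f$ and $(T_n)_{n\ge1}$. Then the following functions of $t>0$ are $\delta$-privacy boundaries for $\mathrm{BM}$. 1. (Mixture boundary) For any $\rho>0$, $$\psi^{M}_\rho(t):=\frac{\Delta_2^2}{2t}+\frac{\Delta_2}{t}\sqrt{2(t+\rho)\log\left(\frac1\delta\sqrt{\frac{t+\rho}{\rho}}\right)}.$$ 2. (Linear boundary) For any $a,b>0$ with $2ab=\log(1/\delta)$, $$\psi^{L}_{a,b}(t):=\frac{\Delta_2}{t}\left(\frac{\Delta_2}{2}+b\right)+\Delta_2a.$$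
   Context: $\mathcal X$ is a set of databases with an arbitrary neighboring relation $\sim$. Privacy loss: for a randomized algorithm $A$ on $\mathcal X$ with values in a measurable space and $x\sim x'$, let $p^x,p^{x'}$ be the densities of the laws of $A(x),A(x')$ with respect to a common reference measure (e.g. the sum of the two laws). The privacy loss between $A(x)$ and $A(x')$ is the random variable $\mathcal L(x,x')=\log\frac{p^x(A(x))}{p^{x'}(A(x))}$ (defined up to almost sure equality). Time functions: a sequence of (measurable) functions $T_n:(\mathbb R^d)^{n-1}\to\mathbb R_{>0}$, $n\ge1$ (so $T_1$ is a constant), with $T_{n+1}(\beta_1,\dots,\beta_n)\le T_n(\beta_1,\dots,\beta_{n-1})$ for all $n\ge1$ and all $\beta_1,\dots,\beta_n\in\mathbb R^d$. Brownian mechanism: let $(B_t)_{t\ge0}$ be a standard $d$-dimensional Brownian motion started at $0$. $\mathrm{BM}(x)=(\mathrm{BM}_n(x))_{n\ge1}$ with $\mathrm{BM}_n(x)=f(x)+B_{T_n(x)}$, where recursively $T_n(x):=T_n(\mathrm{BM}_1(x),\dots,\mathrm{BM}_{n-1}(x))$. Write $\mathrm{BM}_{1:n}(x)=(\mathrm{BM}_1(x),\dots,\mathrm{BM}_n(x))$, and let $\mathcal L^{\mathrm{BM}}_{1:n}(x,x')$ be the privacy loss between $\mathrm{BM}_{1:n}(x)$ and $\mathrm{BM}_{1:n}(x')$. $\delta$-privacy boundary: a function $\psi:\mathbb R_{>0}\to\mathbb R_{\ge0}$ is a $\delta$-privacy boundary for $\mathrm{BM}$ if for all neighbors $x\sim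 x'$, $$\mathbb P\left(\exists n\ge1:\ \mathcal L^{\mathrm{BM}}_{1:n}(x,x')\ge\psi(T_n(x))\right)\le\delta.$$ *)

theory Defs
  imports "HOL-Probability.Probability"
begin

(* Increments over [s, t] have the law N(0, (t - s) I), written as a product density with respect
   to an orthonormal basis of the Euclidean space 'a; norm on 'a is the l2 norm. *)
definition brownian_motion :: "'w measure \<Rightarrow> (real \<Rightarrow> 'w \<Rightarrow> 'a::euclidean_space) \<Rightarrow> bool" where
  "brownian_motion M B \<longleftrightarrow>
     prob_space M \<and>
     (\<forall>t\<ge>0. B t \<in> borel_measurable M) \<and>
     (AE \<omega> in M. B 0 \<omega> = 0) \<and>
     (\<forall>\<omega>\<in>space M. continuous_on {0..} (\<lambda>t. B t \<omega>)) \<and>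
     (\<forall>s t. 0 \<le> s \<longrightarrow> s < t \<longrightarrow>
        distributed M lborel (\<lambda>\<omega>. B t \<omega> - B s \<omega>)
          (\<lambda>z. ennreal (\<Prod>b\<in>Basis. normal_density 0 (sqrt (t - s)) (z \<bullet> b)))) \<and>
     (\<forall>(\<tau> :: nat \<Rightarrow> real) n. 0 \<le> \<tau> 0 \<longrightarrow> mono \<tau> \<longrightarrow>
        prob_space.indep_vars M (\<lambda>_. borel)
          (\<lambda>i \<omega>. B (\<tau> (Suc i)) \<omega> - B (\<tau> i) \<omega>) {..<n})"

definition l2_sensitivity_le :: "('x \<Rightarrow> 'x \<Rightarrow> bool) \<Rightarrow> ('x \<Rightarrow> 'a::euclidean_space) \<Rightarrow> real \<Rightarrow> bool" where
  "l2_sensitivity_le nbr f \<Delta> \<longleftrightarrow> (\<forall>x x'. nbr x x' \<longrightarrow> norm (f x - f x') \<le> \<Delta>)"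

(* L is a version of the privacy loss between X and Y, random variables on M with values in N.
   The reference measure, the densities and the version are arbitrary. The loss is extended real:
   it is infinite where the density of Y vanishes; the density of X is almost surely positive
   at X. *)
definition privacy_loss ::
  "'w measure \<Rightarrow> 'b measure \<Rightarrow> ('w \<Rightarrow> 'b) \<Rightarrow> ('w \<Rightarrow> 'b) \<Rightarrow> ('w \<Rightarrow> ereal) \<Rightarrow> bool" where
  "privacy_loss M N X Y L \<longleftrightarrow>
     L \<in> borel_measurable M \<and>
     (\<exists>\<mu> p q. p \<in> borel_measurable \<mu> \<and> q \<in> borel_measurable \<mu> \<and>
        (\<forall>z. 0 \<le> p z) \<and> (\<forall>z. 0 \<le> q z) \<and>
        distr M N X = density \<mu> (\<lambda>z. ennreal (p z)) \<and>
        distr M N Y = density \<mu> (\<lambda>z. ennreal (q z)) \<and>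
        (AE \<omega> in M. L \<omega> = (if q (X \<omega>) = 0 then \<infinity> else ereal (ln (p (X \<omega>) / q (X \<omega>))))))"

(* A privacy loss always exists (reference measure: the sum of the two laws). *)
lemma privacy_loss_exists:
  fixes M :: "'w measure" and N :: "'b measure"
  assumes M: "prob_space M" and X[measurable]: "X \<in> measurable M N" and Y[measurable]: "Y \<in> measurable M N"
  shows "\<exists>L. privacy_loss M N X Y L"
proof -
  interpret prob_space M by (rule M)
  define P where "P = distr M N X"
  define Q where "Q = distr M N Y"
  interpret P: prob_space P unfolding P_def by (rule prob_space_distr) fact
  interpret Q: prob_space Q unfolding Q_def by (rule prob_space_distr) fact
  define R where "R = measure_of (space N) (sets N) (\<lambda>E. emeasure P E + emeasure Q E)"
  have sR[simp]: "sets R = sets N" "space R = space N" by (simp_all add: R_def)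
  have sP[simp]: "sets P = sets N" "sets Q = sets N" "space P = space N" "space Q = space N"
    by (simp_all add: P_def Q_def)
  have eR: "emeasure R E = emeasure P E + emeasure Q E" if "E \<in> sets N" for E
  proof (rule emeasure_measure_of[OF R_def])
    show "countably_additive (sets R) (\<lambda>E. emeasure P E + emeasure Q E)"
    proof (rule countably_additiveI)
      fix A :: "nat \<Rightarrow> 'b set"
      assume A: "range A \<subseteq> sets R" "disjoint_family A"
      have "(\<Sum>i. emeasure P (A i) + emeasure Q (A i)) =
          (\<Sum>i. emeasure P (A i)) + (\<Sum>i. emeasure Q (A i))"
        by (rule suminf_add[symmetric]) auto
      with A show "(\<Sum>i. emeasure P (A i) + emeasure Q (A i)) =
          emeasure P (\<Union>i. A i) + emeasure Q (\<Union>i. A i)"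
        by (simp add: suminf_emeasure)
    qed
  qed (use that sets.space_closed in \<open>auto simp: positive_def\<close>)
  interpret R: finite_measure R
    by standard (use P.emeasure_finite Q.emeasure_finite in \<open>simp add: eR\<close>)
  have acP: "absolutely_continuous R P" and acQ: "absolutely_continuous R Q"
    by (auto simp: absolutely_continuous_def null_sets_def eR)
  define p where "p = (\<lambda>z. enn2real (RN_deriv R P z))"
  define q where "q = (\<lambda>z. enn2real (RN_deriv R Q z))"
  have m: "p \<in> borel_measurable R" "q \<in> borel_measurable R"
    unfolding p_def q_def by measurable
  have dens: "density R (\<lambda>z. ennreal (enn2real (RN_deriv R S z))) = S"
    if "absolutely_continuous R S" "sigma_finite_measure S" "sets S = sets N" for S
  proof -
    have "density R (\<lambda>z. ennreal (enn2real (RN_deriv R S z))) = density R (RN_deriv R S)"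
      by (rule density_cong)
        (use R.RN_deriv_finite[of S] that in \<open>auto elim!: eventually_mono simp: less_top\<close>)
    also have "\<dots> = S"
      using R.density_RN_deriv[of S] that by simp
    finally show ?thesis .
  qed
  have mN[measurable]: "p \<in> borel_measurable N" "q \<in> borel_measurable N"
    using m by (simp_all cong: measurable_cong_sets)
  define L :: "'w \<Rightarrow> ereal" where
    "L = (\<lambda>\<omega>. if q (X \<omega>) = 0 then \<infinity> else ereal (ln (p (X \<omega>) / q (X \<omega>))))"
  have "L \<in> borel_measurable M"
    unfolding L_def by measurable
  moreover have "distr M N X = density R (\<lambda>z. ennreal (p z))"
    using dens[OF acP P.sigma_finite_measure_axioms] by (simp add: p_def P_def)
  moreover have "distr M N Y = density R (\<lambda>z. ennreal (q z))"
    using dens[OF acQ Q.sigma_finite_measure_axioms] by (simp add: q_def Q_def)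
  moreover have "\<forall>z. 0 \<le> p z" "\<forall>z. 0 \<le> q z"
    by (simp_all add: p_def q_def)
  ultimately have "privacy_loss M N X Y L"
    unfolding privacy_loss_def using m by (intro conjI exI[of _ R] exI[of _ p] exI[of _ q]) (auto simp: L_def)
  then show ?thesis by blast
qed

(* A tuple (b_1, ..., b_k) is an element of the product space PiM {1..k}, i.e. a function on nat
   that is undefined outside {1..k}. T 0 is junk. *)
definition time_functions :: "(nat \<Rightarrow> (nat \<Rightarrow> 'a::euclidean_space) \<Rightarrow> real) \<Rightarrow> bool" where
  "time_functions T \<longleftrightarrow>
     (\<forall>n\<ge>1. T n \<in> borel_measurable (PiM {1..<n} (\<lambda>_. borel)) \<and>
        (\<forall>\<beta>\<in>space (PiM {1..<n} (\<lambda>_. borel)). 0 < T n \<beta>) \<and>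
        (\<forall>\<beta>\<in>space (PiM {1..n} (\<lambda>_. borel)). T (Suc n) \<beta> \<le> T n (restrict \<beta> {1..<n})))"

lemma restrict_fundef_cong [fundef_cong]:
  "I = J \<Longrightarrow> (\<And>i. i \<in> J \<Longrightarrow> f i = g i) \<Longrightarrow> restrict f I = restrict g J"
  by (auto simp: restrict_def)

(* Argument y is the true value f x; only indices n >= 1 are meaningful. *)
function brownian_mechanism ::
  "(real \<Rightarrow> 'w \<Rightarrow> 'a::euclidean_space) \<Rightarrow> (nat \<Rightarrow> (nat \<Rightarrow> 'a) \<Rightarrow> real) \<Rightarrow> 'a \<Rightarrow> nat \<Rightarrow> 'w \<Rightarrow> 'a" where
  "brownian_mechanism B T y n \<omega> =
     y + B (T n (\<lambda>i\<in>{1..<n}. brownian_mechanism B T y i \<omega>)) \<omega>"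
  by pat_completeness auto
termination
  by (relation "Wellfounded.measure (\<lambda>(B, T, y, n, \<omega>). n)") auto

declare brownian_mechanism.simps [simp del]

definition brownian_prefix ::
  "(real \<Rightarrow> 'w \<Rightarrow> 'a::euclidean_space) \<Rightarrow> (nat \<Rightarrow> (nat \<Rightarrow> 'a) \<Rightarrow> real) \<Rightarrow> 'a \<Rightarrow> nat \<Rightarrow> 'w \<Rightarrow> (nat \<Rightarrow> 'a)" where
  "brownian_prefix B T y n \<omega> = (\<lambda>i\<in>{1..n}. brownian_mechanism B T y i \<omega>)"

definition brownian_time ::
  "(real \<Rightarrow> 'w \<Rightarrow> 'a::euclidean_space) \<Rightarrow> (nat \<Rightarrow> (nat \<Rightarrow> 'a) \<Rightarrow> real) \<Rightarrow> 'a \<Rightarrow> nat \<Rightarrow> 'w \<Rightarrow> real" where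
  "brownian_time B T y n \<omega> = T n (\<lambda>i\<in>{1..<n}. brownian_mechanism B T y i \<omega>)"

(* Membership of the event in sets M is explicit because measure M is 0 on non-measurable sets. *)
definition privacy_boundary ::
  "'w measure \<Rightarrow> (real \<Rightarrow> 'w \<Rightarrow> 'a::euclidean_space) \<Rightarrow> ('x \<Rightarrow> 'x \<Rightarrow> bool) \<Rightarrow> ('x \<Rightarrow> 'a) \<Rightarrow>
   (nat \<Rightarrow> (nat \<Rightarrow> 'a) \<Rightarrow> real) \<Rightarrow> real \<Rightarrow> (real \<Rightarrow> real) \<Rightarrow> bool" where
  "privacy_boundary M B nbr f T \<delta> \<psi> \<longleftrightarrow>
     (\<forall>t>0. 0 \<le> \<psi> t) \<and>
     (\<forall>x x' L. nbr x x' \<longrightarrow>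
        (\<forall>n\<ge>1. privacy_loss M (PiM {1..n} (\<lambda>_. borel))
           (brownian_prefix B T (f x) n) (brownian_prefix B T (f x') n) (L n)) \<longrightarrow>
        (let E = {\<omega> \<in> space M. \<exists>n\<ge>1. ereal (\<psi> (brownian_time B T (f x) n \<omega>)) \<le> L n \<omega>}
         in E \<in> sets M \<and> measure M E \<le> \<delta>))"

definition mixture_boundary :: "real \<Rightarrow> real \<Rightarrow> real \<Rightarrow> real \<Rightarrow> real" where
  "mixture_boundary \<Delta> \<delta> \<rho> t =
     \<Delta>\<^sup>2 / (2 * t) + \<Delta> / t * sqrt (2 * (t + \<rho>) * ln (1 / \<delta> * sqrt ((t + \<rho>) / \<rho>)))"

definition linear_boundary :: "real \<Rightarrow> real \<Rightarrow> real \<Rightarrow> real \<Rightarrow> real" where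
  "linear_boundary \<Delta> a b t = \<Delta> / t * (\<Delta> / 2 + b) + \<Delta> * a"

end

theory Submission
  imports Defs
begin

text \<open>Let \<open>v = f x' - f x\<close>. For fixed \<open>s > 0\<close> the law of \<open>(B\<^sub>t + v)\<close>, \<open>t \<ge> s\<close>, has density
  \<open>exp (\<langle>B\<^sub>s, v\<rangle> / s - \<bar>v\<bar>\<^sup>2 / 2s)\<close> with respect to that of \<open>(B\<^sub>t)\<close>, \<open>t \<ge> s\<close>, because the later
  increments are independent of \<open>B\<^sub>s\<close>. The outputs on the event that the n-th time lies in the
  dyadic cell \<open>[s, s')\<close> depend only on the path after \<open>s\<close>, so this density may be used cell by
  cell; letting the mesh tend to 0, Fatou's lemma shows that the law of the outputs for \<open>x'\<close>
  dominates \<open>exp (\<langle>B\<^sub>t, v\<rangle> / t - \<bar>v\<bar>\<^sup>2 / 2t)\<close>, at \<open>t = T\<^sub>n\<close>, times the law for \<open>x\<close>. This inequality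
  bounds the privacy loss by \<open>(\<bar>v\<bar>\<^sup>2 / 2 - \<langle>B\<^sub>t, v\<rangle>) / t\<close> almost surely. What remains is a time-uniform
  bound on the real Brownian motion \<open>- \<langle>B\<^sub>t, v\<rangle> / \<bar>v\<bar>\<close>: Ville's inequality for an exponential
  martingale, or for a Gaussian mixture of such martingales.\<close>

section \<open>Gaussian densities and independence\<close>

text \<open>Density of N(0, t I): the index \<open>t\<close> is the variance, and the product over
  \<open>Basis\<close> repeats the form in which \<open>brownian_motion\<close> gives the law of an
  increment.\<close>

definition gauss :: "real \<Rightarrow> 'a::euclidean_space \<Rightarrow> real" where
  "gauss t z = (\<Prod>b\<in>Basis. normal_density 0 (sqrt t) (z \<bullet> b))"

text \<open>Cameron-Martin density of N(v, t I) with respect to N(0, t I), at the point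
  \<open>z\<close>.\<close>

definition gauss_tilt :: "real \<Rightarrow> 'a::euclidean_space \<Rightarrow> 'a \<Rightarrow> real" where
  "gauss_tilt t v z = exp (z \<bullet> v / t - v \<bullet> v / (2 * t))"

lemma gauss_nonneg: "0 \<le> gauss t z"
  by (auto simp: gauss_def intro!: prod_nonneg)

lemma borel_measurable_gauss [measurable]: "gauss t \<in> borel_measurable borel"
  unfolding gauss_def[abs_def] by measurable

lemma borel_measurable_gauss_tilt [measurable]:
  assumes [measurable]: "f \<in> borel_measurable M" "g \<in> borel_measurable M"
  shows "(\<lambda>x. gauss_tilt (f x) v (g x)) \<in> borel_measurable M"
  unfolding gauss_tilt_def[abs_def] by measurable

lemma normal_density_tilt:
  assumes "0 < t"
  shows "normal_density 0 (sqrt t) x * exp (x * c / t - c * c / (2 * t)) =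
    normal_density 0 (sqrt t) (x - c)"
proof -
  have "- x\<^sup>2 / (2 * t) + (x * c / t - c * c / (2 * t)) = - (x - c)\<^sup>2 / (2 * t)"
    using assms by (simp add: field_simps power2_eq_square)
  then show ?thesis
    using assms by (simp add: normal_density_def flip: exp_add)
qed

text \<open>The exponent of the tilt splits over an orthonormal basis; in each coordinate,
  completing the square recentres the normal density.\<close>

lemma gauss_times_gauss_tilt:
  assumes "0 < t"
  shows "gauss t z * gauss_tilt t v z = gauss t (z - v)"
proof -
  have "gauss_tilt t v z =
    (\<Prod>b\<in>Basis. exp ((z \<bullet> b) * (v \<bullet> b) / t - (v \<bullet> b) * (v \<bullet> b) / (2 * t)))"
    unfolding gauss_tilt_def euclidean_inner[of z v] euclidean_inner[of v v]
    by (simp add: exp_sum[symmetric] sum_subtractf sum_divide_distrib)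
  then show ?thesis
    using assms
    by (simp add: gauss_def normal_density_tilt inner_diff_left flip: prod.distrib)
qed

text \<open>Tilting recentres the Gaussian at \<open>v\<close>, and translation invariance of
  Lebesgue measure moves the shift into the integrand.\<close>

lemma nn_integral_gauss_tilt:
  assumes t: "0 < t" and [measurable]: "g \<in> borel_measurable borel"
  shows "(\<integral>\<^sup>+z. ennreal (gauss_tilt t v z) * g z \<partial>density lborel (gauss t)) =
    (\<integral>\<^sup>+z. g (z + v) \<partial>density lborel (gauss t))"
proof -
  have "(\<integral>\<^sup>+z. ennreal (gauss_tilt t v z) * g z \<partial>density lborel (gauss t)) =
    (\<integral>\<^sup>+z. ennreal (gauss t z * gauss_tilt t v z) * g z \<partial>lborel)"
    by (subst nn_integral_density)
      (auto simp: ennreal_mult' gauss_nonneg mult.assoc intro!: nn_integral_cong)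
  also have "\<dots> = (\<integral>\<^sup>+z. ennreal (gauss t (z - v)) * g z \<partial>distr lborel borel ((+) v))"
    using t by (simp add: gauss_times_gauss_tilt lborel_distr_plus)
  also have "\<dots> = (\<integral>\<^sup>+z. ennreal (gauss t z) * g (z + v) \<partial>lborel)"
    by (subst nn_integral_distr) (auto simp: add.commute)
  also have "\<dots> = (\<integral>\<^sup>+z. g (z + v) \<partial>density lborel (gauss t))"
    by (subst nn_integral_density) auto
  finally show ?thesis .
qed

lemma (in prob_space) nn_integral_indep_var:
  assumes ind: "indep_var A X C Y"
    and [measurable]: "case_prod G \<in> borel_measurable (A \<Otimes>\<^sub>M C)"
  shows "(\<integral>\<^sup>+\<omega>. G (X \<omega>) (Y \<omega>) \<partial>M) = (\<integral>\<^sup>+\<omega>. (\<integral>\<^sup>+y. G (X \<omega>) y \<partial>distr M C Y) \<partial>M)"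
proof -
  have [measurable]: "X \<in> measurable M A" "Y \<in> measurable M C"
    using ind by (auto dest: indep_var_rv1 indep_var_rv2)
  interpret Y: prob_space "distr M C Y" by (rule prob_space_distr) simp
  have "(\<integral>\<^sup>+\<omega>. G (X \<omega>) (Y \<omega>) \<partial>M) =
    (\<integral>\<^sup>+z. case_prod G z \<partial>distr M (A \<Otimes>\<^sub>M C) (\<lambda>\<omega>. (X \<omega>, Y \<omega>)))"
    by (subst nn_integral_distr) auto
  also have "\<dots> = (\<integral>\<^sup>+z. case_prod G z \<partial>(distr M A X \<Otimes>\<^sub>M distr M C Y))"
    using ind by (simp add: indep_var_distribution_eq)
  also have "\<dots> = (\<integral>\<^sup>+x. (\<integral>\<^sup>+y. G x y \<partial>distr M C Y) \<partial>distr M A X)"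
    by (subst Y.nn_integral_fst[symmetric]) auto
  also have "\<dots> = (\<integral>\<^sup>+\<omega>. (\<integral>\<^sup>+y. G (X \<omega>) y \<partial>distr M C Y) \<partial>M)"
    by (subst nn_integral_distr) auto
  finally show ?thesis .
qed

text \<open>Independence of the family gives independence of the blocks \<open>K\<close> and
  \<open>{i}\<close>. Both live on product spaces, so the single component is first read as a point
  over \<open>{i}\<close> and then recovered by evaluation at \<open>i\<close>.\<close>

lemma (in prob_space) nn_integral_indep_vars_component:
  assumes ind: "indep_vars N X I" and K: "K \<subseteq> I" "i \<in> I" "i \<notin> K"
    and [measurable]: "case_prod G \<in> borel_measurable (PiM K N \<Otimes>\<^sub>M N i)"
  shows "(\<integral>\<^sup>+\<omega>. G (\<lambda>j\<in>K. X j \<omega>) (X i \<omega>) \<partial>M) =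
    (\<integral>\<^sup>+\<omega>. (\<integral>\<^sup>+y. G (\<lambda>j\<in>K. X j \<omega>) y \<partial>distr M (N i) (X i)) \<partial>M)"
proof -
  have X[measurable]: "X i \<in> measurable M (N i)" "\<And>j. j \<in> K \<Longrightarrow> X j \<in> measurable M (N j)"
    using ind K by (auto simp: indep_vars_def)
  have XK[measurable]: "(\<lambda>\<omega>. \<lambda>j\<in>K. X j \<omega>) \<in> measurable M (PiM K N)"
    "(\<lambda>\<omega>. \<lambda>j\<in>{i}. X j \<omega>) \<in> measurable M (PiM {i} N)"
    by (auto intro!: measurable_restrict)
  have "(\<integral>\<^sup>+\<omega>. G (\<lambda>j\<in>K. X j \<omega>) ((\<lambda>j\<in>{i}. X j \<omega>) i) \<partial>M) =
    (\<integral>\<^sup>+\<omega>. (\<integral>\<^sup>+y. G (\<lambda>j\<in>K. X j \<omega>) (y i)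
      \<partial>distr M (PiM {i} N) (\<lambda>\<omega>. \<lambda>j\<in>{i}. X j \<omega>)) \<partial>M)"
    by (rule nn_integral_indep_var[OF indep_var_restrict[OF ind]]) (use K in simp_all)
  also have "\<dots> = (\<integral>\<^sup>+\<omega>. (\<integral>\<^sup>+y. G (\<lambda>j\<in>K. X j \<omega>) y \<partial>distr M (N i) (X i)) \<partial>M)"
  proof (rule nn_integral_cong)
    fix \<omega> assume [simp]: "\<omega> \<in> space M"
    have [measurable]: "(\<lambda>j\<in>K. X j \<omega>) \<in> space (PiM K N)"
      by (rule measurable_space[OF XK(1)]) simp
    show "(\<integral>\<^sup>+y. G (\<lambda>j\<in>K. X j \<omega>) (y i) \<partial>distr M (PiM {i} N) (\<lambda>\<omega>. \<lambda>j\<in>{i}. X j \<omega>)) =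
      (\<integral>\<^sup>+y. G (\<lambda>j\<in>K. X j \<omega>) y \<partial>distr M (N i) (X i))"
      by (simp add: nn_integral_distr)
  qed
  finally show ?thesis by simp
qed

text \<open>With the other components fixed, the inner integral is Gaussian in \<open>X i\<close>
  alone, where the tilt amounts to a shift.\<close>

lemma (in prob_space) nn_integral_indep_gauss_tilt:
  fixes X :: "'i \<Rightarrow> 'a \<Rightarrow> 'b::euclidean_space"
  assumes ind: "indep_vars (\<lambda>_. borel) X I" and K: "K \<subseteq> I" "i \<in> I" "i \<notin> K" and t: "0 < t"
    and Y: "distr M borel (X i) = density lborel (gauss t)"
    and [measurable]: "case_prod H \<in> borel_measurable (PiM K (\<lambda>_. borel) \<Otimes>\<^sub>M borel)"
  shows "(\<integral>\<^sup>+\<omega>. ennreal (gauss_tilt t v (X i \<omega>)) * H (\<lambda>j\<in>K. X j \<omega>) (X i \<omega>) \<partial>M) =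
    (\<integral>\<^sup>+\<omega>. H (\<lambda>j\<in>K. X j \<omega>) (X i \<omega> + v) \<partial>M)"
proof -
  have XK[measurable]: "(\<lambda>\<omega>. \<lambda>j\<in>K. X j \<omega>) \<in> measurable M (PiM K (\<lambda>_. borel))"
    using ind K by (intro measurable_restrict) (auto simp: indep_vars_def)
  have "(\<integral>\<^sup>+\<omega>. ennreal (gauss_tilt t v (X i \<omega>)) * H (\<lambda>j\<in>K. X j \<omega>) (X i \<omega>) \<partial>M) =
    (\<integral>\<^sup>+\<omega>. (\<integral>\<^sup>+y. ennreal (gauss_tilt t v y) * H (\<lambda>j\<in>K. X j \<omega>) y
      \<partial>density lborel (gauss t)) \<partial>M)"
    by (subst nn_integral_indep_vars_component[OF ind K,
          where G = "\<lambda>z y. ennreal (gauss_tilt t v y) * H z y"])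
      (simp_all add: Y)
  also have "\<dots> = (\<integral>\<^sup>+\<omega>. (\<integral>\<^sup>+y. H (\<lambda>j\<in>K. X j \<omega>) (y + v) \<partial>density lborel (gauss t)) \<partial>M)"
  proof (rule nn_integral_cong)
    fix \<omega> assume [simp]: "\<omega> \<in> space M"
    have "(\<lambda>j\<in>K. X j \<omega>) \<in> space (PiM K (\<lambda>_. borel :: 'b measure))"
      by (rule measurable_space[OF XK]) simp
    then have "(\<lambda>y. H (\<lambda>j\<in>K. X j \<omega>) y) \<in> borel_measurable borel" by measurable
    then show "(\<integral>\<^sup>+y. ennreal (gauss_tilt t v y) * H (\<lambda>j\<in>K. X j \<omega>) y
        \<partial>density lborel (gauss t)) =
      (\<integral>\<^sup>+y. H (\<lambda>j\<in>K. X j \<omega>) (y + v) \<partial>density lborel (gauss t))"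
      by (rule nn_integral_gauss_tilt[OF t])
  qed
  also have "\<dots> = (\<integral>\<^sup>+\<omega>. H (\<lambda>j\<in>K. X j \<omega>) (X i \<omega> + v) \<partial>M)"
    by (subst nn_integral_indep_vars_component[OF ind K, where G = "\<lambda>z y. H z (y + v)"])
      (simp_all add: Y)
  finally show ?thesis .
qed

section \<open>Tilting the Brownian path\<close>

text \<open>Puts finitely many times on one grid starting with 0 and \<open>s\<close>, in the form
  in which \<open>brownian_motion\<close> provides independent increments. The sequence is constant
  after the last point, hence monotone but not strictly.\<close>

lemma finite_subset_mono_sequence:
  fixes s :: real
  assumes J: "finite J" and s: "0 < s" "\<And>t. t \<in> J \<Longrightarrow> s \<le> t"
  obtains \<tau> :: "nat \<Rightarrow> real" and n where
    "mono \<tau>" "\<tau> 0 = 0" "\<tau> 1 = s" "0 < n" "J \<subseteq> \<tau> ` {1..n}"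
proof -
  define xs where "xs = sorted_list_of_set (insert s J)"
  have fin: "finite (insert s J)" using J by simp
  have xs: "sorted xs" "set xs = insert s J"
    using fin unfolding xs_def by (auto simp del: sorted_list_of_set_insert_remove sorted_list_of_set.sorted_key_list_of_set_insert_remove)
  then have len: "0 < length xs" by (cases xs) auto
  have "xs ! 0 = s"
  proof (rule antisym)
    show "s \<le> xs ! 0" using xs len s by (metis insertE nth_mem order_refl)
    obtain i where "i < length xs" "xs ! i = s"
      using xs by (metis in_set_conv_nth insertI1)
    then show "xs ! 0 \<le> s" using xs(1) by (metis sorted_nth_mono zero_le)
  qed
  define \<tau> where "\<tau> i = (if i = 0 then 0 else xs ! min (i - 1) (length xs - 1))" for i
  have "0 \<le> xs ! i" if "i < length xs" for i
    using that xs s by (metis insertE less_imp_le nth_mem order_trans)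
  then have "mono \<tau>"
    using len by (auto simp: mono_def \<tau>_def min_less_iff_disj intro!: sorted_nth_mono xs)
  moreover have "\<tau> 0 = 0" "\<tau> 1 = s"
    using \<open>xs ! 0 = s\<close> by (simp_all add: \<tau>_def)
  moreover have "J \<subseteq> \<tau> ` {1..length xs}"
  proof
    fix t assume "t \<in> J"
    then obtain i where "i < length xs" "xs ! i = t"
      using xs by (metis in_set_conv_nth insertI2)
    then have "\<tau> (Suc i) = t" "Suc i \<in> {1..length xs}" by (auto simp: \<tau>_def min_def)
    then show "t \<in> \<tau> ` {1..length xs}" by blast
  qed
  ultimately show thesis using that len by blast
qed

lemma brownian_increments:
  assumes bm: "brownian_motion M B" and "0 \<le> \<tau> 0" "mono \<tau>"
  shows "prob_space.indep_vars M (\<lambda>_. borel)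
    (\<lambda>i \<omega>. B (\<tau> (Suc i)) \<omega> - B (\<tau> i) \<omega>) {..<n::nat}"
  using assms by (auto simp: brownian_motion_def)

lemma distr_brownian_increment:
  assumes "brownian_motion M B" "0 \<le> s" "s < t"
  shows "distr M borel (\<lambda>\<omega>. B t \<omega> - B s \<omega>) = density lborel (gauss (t - s))"
  using assms
  by (auto simp: brownian_motion_def distributed_def gauss_def[abs_def] cong: distr_cong)

lemma
  assumes "brownian_motion M B"
  shows brownian_prob_space: "prob_space M"
    and brownian_measurable: "0 \<le> t \<Longrightarrow> B t \<in> borel_measurable M"
    and brownian_start: "AE \<omega> in M. B 0 \<omega> = 0"
    and brownian_continuous: "\<omega> \<in> space M \<Longrightarrow> continuous_on {0..} (\<lambda>t. B t \<omega>)"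
  using assms by (auto simp: brownian_motion_def)

text \<open>Cameron-Martin formula for the path from time \<open>s\<close> on. That path is
  \<open>B s\<close> plus increments independent of it, so shifting \<open>B s\<close> by
  \<open>v\<close> shifts the whole path. Through \<open>max s t\<close> the path before
  \<open>s\<close> is frozen and becomes a function of \<open>B s\<close>.\<close>

lemma nn_integral_brownian_path_tilt:
  fixes B :: "real \<Rightarrow> 'w \<Rightarrow> 'a::euclidean_space"
  assumes bm: "brownian_motion M B" and s: "0 < s"
    and [measurable]: "G \<in> borel_measurable (PiM UNIV (\<lambda>_. borel))"
  shows "(\<integral>\<^sup>+\<omega>. ennreal (gauss_tilt s v (B s \<omega>)) * G (\<lambda>t. B (max s t) \<omega>) \<partial>M) =
    (\<integral>\<^sup>+\<omega>. G (\<lambda>t. B (max s t) \<omega> + v) \<partial>M)"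
proof -
  interpret prob_space M by (rule brownian_prob_space[OF bm])
  have B[measurable]: "B t \<in> borel_measurable M" if "0 \<le> t" for t
    by (rule brownian_measurable[OF bm that])
  have Bs[measurable]: "B s \<in> borel_measurable M" "\<And>t. B (max s t) \<in> borel_measurable M"
    using s by (auto intro!: B)
  define R where "R \<omega> = ennreal (gauss_tilt s v (B s \<omega>))" for \<omega>
  have [measurable]: "R \<in> borel_measurable M" unfolding R_def by measurable
  define N where "N = PiM (UNIV :: real set) (\<lambda>_. borel :: 'a measure)"
  define P where "P = distr (density M R) N (\<lambda>\<omega> t. B (max s t) \<omega>)"
  define Q where "Q = distr M N (\<lambda>\<omega> t. B (max s t) \<omega> + v)"
  have m[measurable]: "(\<lambda>\<omega> t. B (max s t) \<omega>) \<in> measurable M N"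
    "(\<lambda>\<omega> t. B (max s t) \<omega> + v) \<in> measurable M N"
    unfolding N_def by (auto intro!: measurable_PiM_single')
  have "Q = P"
  proof (rule measure_eqI_PiM_infinite)
    show "sets Q = sets (PiM UNIV (\<lambda>_. borel))" "sets P = sets (PiM UNIV (\<lambda>_. borel))"
      by (simp_all add: P_def Q_def N_def)
    show "finite_measure Q"
      unfolding Q_def by (intro prob_space.finite_measure prob_space_distr) simp
    fix A :: "real \<Rightarrow> 'a set" and J :: "real set"
    assume J: "finite J" and A: "\<And>t. t \<in> J \<Longrightarrow> A t \<in> sets borel"
    define E where "E = prod_emb UNIV (\<lambda>_. borel :: 'a measure) J (Pi\<^sub>E J A)"
    have E_eq: "w \<in> E \<longleftrightarrow> (\<forall>t\<in>J. w t \<in> A t)" for w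
      by (auto simp: E_def prod_emb_def PiE_iff)
    have E[measurable]: "E \<in> sets N"
      unfolding E_def N_def by (intro sets_PiM_I) (use J A in auto)
    have "finite (max s ` J)" using J by simp
    then obtain \<tau> and n :: nat where \<tau>: "mono \<tau>" "\<tau> 0 = 0" "\<tau> 1 = s" and n: "0 < n"
      and "max s ` J \<subseteq> \<tau> ` {1..n}"
      by (rule finite_subset_mono_sequence[OF _ s]) auto
    then have "\<forall>t\<in>J. \<exists>i. i \<in> {1..n} \<and> \<tau> i = max s t"
      by (metis image_iff subsetD imageI)
    then obtain idx where idx: "\<And>t. t \<in> J \<Longrightarrow> idx t \<in> {1..n}" "\<And>t. t \<in> J \<Longrightarrow> \<tau> (idx t) = max s t"
      by metis
    \<comment> \<open>\<open>X 0\<close> is the increment from 0 to \<open>s\<close>, almost surely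
      equal to \<open>B s\<close>; \<open>Z\<close> collects the later increments, which the tilt
      does not touch.\<close>
    define X where "X i \<omega> = B (\<tau> (Suc i)) \<omega> - B (\<tau> i) \<omega>" for i \<omega>
    define Z where "Z = (\<lambda>\<omega>. \<lambda>i\<in>{1..<n}. X i \<omega>)"
    have ind: "indep_vars (\<lambda>_. borel) X {..<n}"
      unfolding X_def by (rule brownian_increments[OF bm]) (use \<tau> in auto)
    have X0: "distr M borel (X 0) = density lborel (gauss s)"
      using distr_brownian_increment[OF bm order_refl s] \<tau>(2,3) unfolding X_def by simp
    \<comment> \<open>Membership in the cylinder, read off from the value \<open>y\<close> at time
      \<open>s\<close> and the later increments \<open>z\<close>. As \<open>idx t\<close> is at
      least 1, the sum starts right after the increment held in \<open>y\<close>.\<close>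
    define H :: "(nat \<Rightarrow> 'a) \<Rightarrow> 'a \<Rightarrow> ennreal" where
      "H z y = (if \<forall>t\<in>J. y + (\<Sum>j\<in>{1..<idx t}. z j) \<in> A t then 1 else 0)" for z y
    have H: "case_prod H \<in> borel_measurable (PiM {1..<n} (\<lambda>_. borel) \<Otimes>\<^sub>M borel)"
    proof -
      have [measurable]: "(\<lambda>(z, y). y + (\<Sum>j\<in>{1..<idx t}. z j)) \<in>
          borel_measurable (PiM {1..<n} (\<lambda>_. borel :: 'a measure) \<Otimes>\<^sub>M borel)" if "t \<in> J" for t
      proof -
        have "j \<in> {1..<n}" if "j \<in> {1..<idx t}" for j
          using that idx(1)[OF \<open>t \<in> J\<close>] by auto
        then have "\<And>j. j \<in> {1..<idx t} \<Longrightarrow> (\<lambda>p. fst p j) \<in>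
            borel_measurable (PiM {1..<n} (\<lambda>_. borel :: 'a measure) \<Otimes>\<^sub>M (borel :: 'a measure))"
          by measurable
        then show ?thesis unfolding case_prod_beta by measurable
      qed
      show ?thesis
        unfolding H_def case_prod_beta using J A by measurable
    qed
    have "AE \<omega> in M. \<forall>t\<in>J. B (max s t) \<omega> = X 0 \<omega> + (\<Sum>j\<in>{1..<idx t}. Z \<omega> j)"
      using brownian_start[OF bm]
    proof (eventually_elim, intro ballI)
      fix \<omega> t assume 0: "B 0 \<omega> = 0" and t: "t \<in> J"
      have "(\<Sum>j\<in>{1..<idx t}. Z \<omega> j) = (\<Sum>j\<in>{1..<idx t}. B (\<tau> (Suc j)) \<omega> - B (\<tau> j) \<omega>)"
        by (rule sum.cong) (use idx(1)[OF t] in \<open>auto simp: Z_def X_def\<close>)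
      also have "\<dots> = B (\<tau> (idx t)) \<omega> - B (\<tau> 1) \<omega>"
        by (rule sum_Suc_diff') (use idx(1)[OF t] in auto)
      finally show "B (max s t) \<omega> = X 0 \<omega> + (\<Sum>j\<in>{1..<idx t}. Z \<omega> j)"
        using 0 \<tau> idx(2)[OF t] by (simp add: X_def)
    qed
    then have path: "AE \<omega> in M. B s \<omega> = X 0 \<omega> \<and>
        indicator E (\<lambda>t. B (max s t) \<omega>) = H (Z \<omega>) (X 0 \<omega>) \<and>
        indicator E (\<lambda>t. B (max s t) \<omega> + v) = H (Z \<omega>) (X 0 \<omega> + v)"
      using brownian_start[OF bm]
      by eventually_elim (use \<tau> in \<open>auto simp: H_def E_eq X_def indicator_def algebra_simps\<close>)
    have "emeasure P E = (\<integral>\<^sup>+\<omega>. R \<omega> * indicator E (\<lambda>t. B (max s t) \<omega>) \<partial>M)"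
      unfolding P_def
      by (subst nn_integral_indicator[symmetric])
        (simp_all add: nn_integral_distr nn_integral_density del: nn_integral_indicator)
    also have "\<dots> = (\<integral>\<^sup>+\<omega>. ennreal (gauss_tilt s v (X 0 \<omega>)) * H (Z \<omega>) (X 0 \<omega>) \<partial>M)"
      by (rule nn_integral_cong_AE) (use path in eventually_elim, auto simp: R_def)
    also have "\<dots> = (\<integral>\<^sup>+\<omega>. H (Z \<omega>) (X 0 \<omega> + v) \<partial>M)"
      unfolding Z_def by (rule nn_integral_indep_gauss_tilt[OF ind _ _ _ s X0 H]) (use n in auto)
    also have "\<dots> = (\<integral>\<^sup>+\<omega>. indicator E (\<lambda>t. B (max s t) \<omega> + v) \<partial>M)"
      by (rule nn_integral_cong_AE) (use path in eventually_elim, auto)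
    also have "\<dots> = emeasure Q E"
      unfolding Q_def by (subst nn_integral_indicator[symmetric])
        (simp_all add: nn_integral_distr del: nn_integral_indicator)
    finally show "emeasure Q E = emeasure P E" ..
  qed
  have G: "G \<in> borel_measurable N" by (simp add: N_def)
  have "(\<integral>\<^sup>+\<omega>. R \<omega> * G (\<lambda>t. B (max s t) \<omega>) \<partial>M) = (\<integral>\<^sup>+w. G w \<partial>P)"
    unfolding P_def using G by (simp add: nn_integral_distr nn_integral_density)
  also have "\<dots> = (\<integral>\<^sup>+\<omega>. G (\<lambda>t. B (max s t) \<omega> + v) \<partial>M)"
    unfolding \<open>Q = P\<close>[symmetric] Q_def using G by (simp add: nn_integral_distr)
  finally show ?thesis by (simp add: R_def)
qed

section \<open>The mechanism as a functional of the path\<close>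

text \<open>Evaluation at a path-dependent time, made measurable for the product sigma-algebra by
  taking a limit along dyadic points; on continuous paths it is ordinary evaluation. Time comes
  before path so that it can take the place of \<open>B\<close> in
  \<open>brownian_mechanism\<close>, with the path itself as sample point.\<close>

definition dyadic_eval :: "real \<Rightarrow> (real \<Rightarrow> 'a::t2_space) \<Rightarrow> 'a" where
  "dyadic_eval t w = lim (\<lambda>k. w (of_int \<lceil>2 ^ k * t\<rceil> / 2 ^ k))"

lemma
  fixes t :: real
  shows dyadic_ceiling_tendsto: "(\<lambda>k. of_int \<lceil>2 ^ k * t\<rceil> / 2 ^ k) \<longlonglongrightarrow> t"
    and dyadic_floor_tendsto: "(\<lambda>k. of_int \<lfloor>2 ^ k * t\<rfloor> / 2 ^ k) \<longlonglongrightarrow> t"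
proof -
  have 0: "(\<lambda>k. (1 / 2) ^ k :: real) \<longlonglongrightarrow> 0" by (rule LIMSEQ_power_zero) simp
  have up: "(\<lambda>k. t + (1 / 2) ^ k) \<longlonglongrightarrow> t" and lo: "(\<lambda>k. t - (1 / 2) ^ k) \<longlonglongrightarrow> t"
    using tendsto_add[OF tendsto_const[of t] 0] tendsto_diff[OF tendsto_const[of t] 0] by simp_all
  have bounds: "t \<le> of_int \<lceil>2 ^ k * t\<rceil> / 2 ^ k \<and> of_int \<lceil>2 ^ k * t\<rceil> / 2 ^ k \<le> t + (1 / 2) ^ k \<and>
      t - (1 / 2) ^ k \<le> of_int \<lfloor>2 ^ k * t\<rfloor> / 2 ^ k \<and> of_int \<lfloor>2 ^ k * t\<rfloor> / 2 ^ k \<le> t" for k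
  proof -
    have "2 ^ k * t / 2 ^ k \<le> of_int \<lceil>2 ^ k * t\<rceil> / 2 ^ k"
      "of_int \<lceil>2 ^ k * t\<rceil> / 2 ^ k \<le> (2 ^ k * t + 1) / 2 ^ k"
      "(2 ^ k * t - 1) / 2 ^ k \<le> of_int \<lfloor>2 ^ k * t\<rfloor> / 2 ^ k"
      "of_int \<lfloor>2 ^ k * t\<rfloor> / 2 ^ k \<le> 2 ^ k * t / 2 ^ k"
      by (intro divide_right_mono; linarith?; simp)+
    then show ?thesis
      by (simp add: add_divide_distrib diff_divide_distrib power_one_over)
  qed
  show "(\<lambda>k. of_int \<lceil>2 ^ k * t\<rceil> / 2 ^ k) \<longlonglongrightarrow> t"
    by (rule tendsto_sandwich[OF _ _ tendsto_const up]) (use bounds in auto)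
  show "(\<lambda>k. of_int \<lfloor>2 ^ k * t\<rfloor> / 2 ^ k) \<longlonglongrightarrow> t"
    by (rule tendsto_sandwich[OF _ _ lo tendsto_const]) (use bounds in auto)
qed

lemma continuous_on_nonneg_tendsto:
  fixes w :: "real \<Rightarrow> 'a::topological_space"
  assumes "continuous_on {0..} w" "0 \<le> t" "\<And>k. 0 \<le> r k" "r \<longlonglongrightarrow> t"
  shows "(\<lambda>k. w (r k)) \<longlonglongrightarrow> w t"
  by (rule continuous_on_tendsto_compose[OF assms(1,4)]) (use assms in auto)

lemma dyadic_eval_continuous:
  fixes w :: "real \<Rightarrow> 'a::t2_space"
  assumes "continuous_on {0..} w" "0 \<le> t"
  shows "dyadic_eval t w = w t"
  unfolding dyadic_eval_def
proof (intro limI continuous_on_nonneg_tendsto[OF assms] dyadic_ceiling_tendsto)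
  fix k
  have "0 \<le> 2 ^ k * t" using assms(2) by simp
  then have "0 \<le> \<lceil>2 ^ k * t\<rceil>" by linarith
  then show "0 \<le> of_int \<lceil>2 ^ k * t\<rceil> / (2 ^ k :: real)" by simp
qed

text \<open>At a fixed dyadic level the rounded time takes countably many values, so evaluation
  there glues countably many coordinate maps; measurability passes to the limit.\<close>

lemma borel_measurable_dyadic_eval:
  fixes \<tau> :: "(real \<Rightarrow> 'a::euclidean_space) \<Rightarrow> real"
  assumes [measurable]: "\<tau> \<in> borel_measurable (PiM UNIV (\<lambda>_. borel))"
  shows "(\<lambda>w. dyadic_eval (\<tau> w) w) \<in> borel_measurable (PiM UNIV (\<lambda>_. borel))"
  unfolding dyadic_eval_def
proof (rule borel_measurable_lim_metric)
  fix k :: nat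
  show "(\<lambda>w. w (of_int \<lceil>2 ^ k * \<tau> w\<rceil> / 2 ^ k)) \<in> borel_measurable (PiM UNIV (\<lambda>_. borel))"
    by (rule measurable_compose_countable[where f = "\<lambda>i w. w (of_int i / 2 ^ k)"
          and g = "\<lambda>w. \<lceil>2 ^ k * \<tau> w\<rceil>"]) measurable
qed

section \<open>Recursion for the outputs and its measurability on path space\<close>

lemma brownian_mechanism_eq:
  "brownian_mechanism B T y n \<omega> = y + B (brownian_time B T y n \<omega>) \<omega>"
  by (simp add: brownian_mechanism.simps[of B T y n] brownian_time_def)

lemma brownian_time_cong:
  assumes "\<And>i. i \<in> {1..<n} \<Longrightarrow>
    brownian_mechanism B T y i \<omega> = brownian_mechanism B' T y' i \<omega>'"
  shows "brownian_time B T y n \<omega> = brownian_time B' T y' n \<omega>'"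
  unfolding brownian_time_def by (intro arg_cong[where f = "T n"] restrict_ext assms)

lemma
  fixes y :: "'a::euclidean_space"
  assumes T: "time_functions T" and n: "1 \<le> n"
  shows measurable_dyadic_mechanism:
      "brownian_mechanism dyadic_eval T y n \<in> borel_measurable (PiM UNIV (\<lambda>_. borel))"
    and measurable_dyadic_time:
      "brownian_time dyadic_eval T y n \<in> borel_measurable (PiM UNIV (\<lambda>_. borel))"
proof -
  have "brownian_mechanism dyadic_eval T y n \<in> borel_measurable (PiM UNIV (\<lambda>_. borel)) \<and>
    brownian_time dyadic_eval T y n \<in> borel_measurable (PiM UNIV (\<lambda>_. borel))"
    using n
  proof (induction n rule: less_induct)
    case (less n)
    have [measurable]: "T n \<in> borel_measurable (PiM {1..<n} (\<lambda>_. borel))"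
      using T less.prems by (simp add: time_functions_def)
    have "(\<lambda>w. \<lambda>i\<in>{1..<n}. brownian_mechanism dyadic_eval T y i w) \<in>
        measurable (PiM UNIV (\<lambda>_. borel)) (PiM {1..<n} (\<lambda>_. borel))"
      by (rule measurable_restrict) (use less.IH in auto)
    then have *: "brownian_time dyadic_eval T y n \<in> borel_measurable (PiM UNIV (\<lambda>_. borel))"
      unfolding brownian_time_def[abs_def] by measurable
    then show ?case
      using borel_measurable_dyadic_eval[OF *]
      by (simp add: brownian_mechanism_eq[abs_def])
  qed
  then show "brownian_mechanism dyadic_eval T y n \<in> borel_measurable (PiM UNIV (\<lambda>_. borel))"
    "brownian_time dyadic_eval T y n \<in> borel_measurable (PiM UNIV (\<lambda>_. borel))"
    by simp_all
qed

lemma measurable_dyadic_prefix: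
  assumes "time_functions T"
  shows "brownian_prefix dyadic_eval T y n \<in>
    measurable (PiM UNIV (\<lambda>_. borel)) (PiM {1..n} (\<lambda>_. borel))"
  unfolding brownian_prefix_def[abs_def]
  by (rule measurable_restrict) (use assms in \<open>auto intro: measurable_dyadic_mechanism\<close>)

section \<open>Monotonicity of the times and dependence on the path after a given time\<close>

lemma brownian_time_pos:
  assumes "time_functions T" "1 \<le> n"
  shows "0 < brownian_time B T y n \<omega>"
  using assms by (auto simp: time_functions_def brownian_time_def space_PiM)

lemma brownian_time_antimono:
  fixes y :: "'a::euclidean_space"
  assumes T: "time_functions T" and "1 \<le> i" "i \<le> n"
  shows "brownian_time B T y n \<omega> \<le> brownian_time B T y i \<omega>"
  using \<open>i \<le> n\<close>
proof (induction n rule: dec_induct)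
  case (step n)
  have "restrict (\<lambda>i\<in>{1..n}. brownian_mechanism B T y i \<omega>) {1..<n} =
    (\<lambda>i\<in>{1..<n}. brownian_mechanism B T y i \<omega>)"
    by auto
  moreover have "{1..<Suc n} = {1..n}" by auto
  moreover have "(\<lambda>i\<in>{1..n}. brownian_mechanism B T y i \<omega>) \<in>
      space (PiM {1..n} (\<lambda>_. borel :: 'a measure))"
    by (auto simp: space_PiM)
  ultimately have "brownian_time B T y (Suc n) \<omega> \<le> brownian_time B T y n \<omega>"
    using T step \<open>1 \<le> i\<close> unfolding time_functions_def brownian_time_def by (metis order_trans)
  then show ?case using step.IH by simp
qed simp

text \<open>The times are nonincreasing, so if the n-th is at least \<open>s\<close>, all earlier
  ones are too, and the recursion up to \<open>n\<close> never reads the path below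
  \<open>s\<close>.\<close>

lemma brownian_mechanism_cong:
  assumes T: "time_functions T" and s: "s \<le> brownian_time B T y n \<omega>"
    and eq: "\<And>t. s \<le> t \<Longrightarrow> B t \<omega> = B' t \<omega>'" and i: "i \<in> {1..n}"
  shows "brownian_mechanism B' T y i \<omega>' = brownian_mechanism B T y i \<omega>"
  using i
proof (induction i rule: less_induct)
  case (less i)
  have time: "brownian_time B' T y i \<omega>' = brownian_time B T y i \<omega>"
    by (rule brownian_time_cong) (use less in auto)
  have "s \<le> brownian_time B T y i \<omega>"
    using s brownian_time_antimono[OF T, of i n B y \<omega>] less.prems by auto
  then show ?case
    by (simp add: brownian_mechanism_eq time eq)
qed

lemma
  assumes "time_functions T" "s \<le> brownian_time B T y n \<omega>"
    "\<And>t. s \<le> t \<Longrightarrow> B t \<omega> = B' t \<omega>'"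
  shows brownian_prefix_cong: "brownian_prefix B' T y n \<omega>' = brownian_prefix B T y n \<omega>"
    and brownian_time_cong': "brownian_time B' T y n \<omega>' = brownian_time B T y n \<omega>"
proof -
  have "brownian_mechanism B' T y i \<omega>' = brownian_mechanism B T y i \<omega>" if "i \<in> {1..n}" for i
    using brownian_mechanism_cong[of T s B y n \<omega> B' \<omega>' i] assms that by blast
  then show "brownian_prefix B' T y n \<omega>' = brownian_prefix B T y n \<omega>"
    "brownian_time B' T y n \<omega>' = brownian_time B T y n \<omega>"
    by (auto simp: brownian_prefix_def intro!: restrict_ext brownian_time_cong)
qed

text \<open>Identifies the mechanism run on a shifted path with the mechanism for another true
  value: this is how a Cameron-Martin shift becomes a change of database.\<close>

lemma brownian_mechanism_shift:
  "brownian_mechanism (\<lambda>t \<omega>. B t \<omega> + v) T y n \<omega> = brownian_mechanism B T (y + v) n \<omega>"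
proof (induction n rule: less_induct)
  case (less n)
  have "brownian_time (\<lambda>t \<omega>. B t \<omega> + v) T y n \<omega> = brownian_time B T (y + v) n \<omega>"
    by (rule brownian_time_cong) (use less in auto)
  then show ?case by (simp add: brownian_mechanism_eq algebra_simps)
qed

lemma
  shows brownian_prefix_shift:
      "brownian_prefix (\<lambda>t \<omega>. B t \<omega> + v) T y n \<omega> = brownian_prefix B T (y + v) n \<omega>"
    and brownian_time_shift:
      "brownian_time (\<lambda>t \<omega>. B t \<omega> + v) T y n \<omega> = brownian_time B T (y + v) n \<omega>"
  by (auto simp: brownian_prefix_def brownian_mechanism_shift intro!: brownian_time_cong)

text \<open>Freezing the path below time s does not affect a mechanism that stays above s: this is
  the stopping time property of the time functions for Brownian motion run backwards.\<close>

lemma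
  fixes C :: "real \<Rightarrow> 'w \<Rightarrow> 'a::euclidean_space"
  assumes T: "time_functions T" and s: "0 \<le> s"
    and cont: "continuous_on {0..} (\<lambda>t. C t \<omega>)"
  defines "w \<equiv> \<lambda>t. C (max s t) \<omega>"
  shows frozen_time_iff:
      "s \<le> brownian_time dyadic_eval T y n w \<longleftrightarrow> s \<le> brownian_time C T y n \<omega>"
    and frozen_time_eq: "s \<le> brownian_time C T y n \<omega> \<Longrightarrow>
      brownian_time dyadic_eval T y n w = brownian_time C T y n \<omega>"
    and frozen_prefix_eq: "s \<le> brownian_time C T y n \<omega> \<Longrightarrow>
      brownian_prefix dyadic_eval T y n w = brownian_prefix C T y n \<omega>"
proof -
  have "continuous_on {0..} w"
    unfolding w_def
    by (rule continuous_on_compose2[OF cont]) (use s in \<open>auto intro!: continuous_intros\<close>)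
  then have eq: "C t \<omega> = dyadic_eval t w" if "s \<le> t" for t
    using s that by (subst dyadic_eval_continuous) (auto simp: w_def max_def)
  show t: "s \<le> brownian_time C T y n \<omega> \<Longrightarrow>
      brownian_time dyadic_eval T y n w = brownian_time C T y n \<omega>"
    by (rule brownian_time_cong'[OF T]) (auto simp: eq)
  show "s \<le> brownian_time C T y n \<omega> \<Longrightarrow>
      brownian_prefix dyadic_eval T y n w = brownian_prefix C T y n \<omega>"
    by (rule brownian_prefix_cong[OF T]) (auto simp: eq)
  \<comment> \<open>The congruence is applied from either side: whichever of the two times is known
    to be at least \<open>s\<close>, the other equals it.\<close>
  show "s \<le> brownian_time dyadic_eval T y n w \<longleftrightarrow> s \<le> brownian_time C T y n \<omega>"
    using t brownian_time_cong'[OF T, of s dyadic_eval y n w C \<omega>] eq by auto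
qed

text \<open>On continuous sample paths the mechanism is the dyadic functional composed with the map
  to path space. Freezing at 0 removes the negative times, about which
  \<open>brownian_motion\<close> says nothing, and is invisible to the mechanism because its times
  are positive.\<close>

lemma
  fixes y :: "'a::euclidean_space"
  assumes T: "time_functions T" and bm: "brownian_motion M B"
  shows measurable_brownian_prefix:
      "brownian_prefix B T y n \<in> measurable M (PiM {1..n} (\<lambda>_. borel))"
    and measurable_brownian_time:
      "1 \<le> n \<Longrightarrow> brownian_time B T y n \<in> borel_measurable M"
proof -
  have path: "(\<lambda>\<omega> t. B (max 0 t) \<omega>) \<in> measurable M (PiM UNIV (\<lambda>_. borel))"
    by (rule measurable_PiM_single') (auto intro: brownian_measurable[OF bm])
  have prefix: "brownian_prefix dyadic_eval T y n (\<lambda>t. B (max 0 t) \<omega>) =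
      brownian_prefix B T y n \<omega>" if "\<omega> \<in> space M" for \<omega>
  proof (cases "n = 0")
    case False
    with brownian_time_pos[OF T, of n B y \<omega>] show ?thesis
      by (intro frozen_prefix_eq[where C = B and s = 0, OF T _ brownian_continuous[OF bm that]]) auto
  qed (simp add: brownian_prefix_def restrict_def)
  show "brownian_prefix B T y n \<in> measurable M (PiM {1..n} (\<lambda>_. borel))"
    using measurable_compose[OF path measurable_dyadic_prefix[OF T, of y n]]
    by (subst measurable_cong[OF prefix[symmetric]])
  assume n: "1 \<le> n"
  have time: "brownian_time dyadic_eval T y n (\<lambda>t. B (max 0 t) \<omega>) =
      brownian_time B T y n \<omega>" if "\<omega> \<in> space M" for \<omega>
    using brownian_time_pos[OF T n, of B y \<omega>]
    by (intro frozen_time_eq[where C = B and s = 0, OF T _ brownian_continuous[OF bm that]]) auto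
  show "brownian_time B T y n \<in> borel_measurable M"
    using measurable_compose[OF path measurable_dyadic_time[OF T n, of y]]
    by (subst measurable_cong[OF time[symmetric]])
qed

section \<open>The privacy loss of the Brownian mechanism\<close>

text \<open>On the event that the n-th time lies in the cell, the outputs are a functional of the
  path frozen below \<open>s\<close>, so the density at the deterministic time \<open>s\<close>
  applies; the shift of the path turns \<open>y\<close> into \<open>y + v\<close>.\<close>

lemma nn_integral_brownian_cell_tilt:
  fixes y :: "'a::euclidean_space"
  assumes T: "time_functions T" and bm: "brownian_motion M B" and n: "1 \<le> n" and s: "0 < s"
    and [measurable]: "F \<in> borel_measurable (PiM {1..n} (\<lambda>_. borel))"
  shows "(\<integral>\<^sup>+\<omega>. ennreal (gauss_tilt s v (B s \<omega>)) *
      (F (brownian_prefix B T y n \<omega>) * indicator {s..<s'} (brownian_time B T y n \<omega>)) \<partial>M) =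
    (\<integral>\<^sup>+\<omega>. F (brownian_prefix B T (y + v) n \<omega>) *
      indicator {s..<s'} (brownian_time B T (y + v) n \<omega>) \<partial>M)"
proof -
  define G where "G w = F (brownian_prefix dyadic_eval T y n w) *
    indicator {s..<s'} (brownian_time dyadic_eval T y n w)" for w
  have [measurable]:
    "brownian_prefix dyadic_eval T y n \<in> measurable (PiM UNIV (\<lambda>_. borel)) (PiM {1..n} (\<lambda>_. borel))"
    "brownian_time dyadic_eval T y n \<in> borel_measurable (PiM UNIV (\<lambda>_. borel))"
    using measurable_dyadic_prefix[OF T] measurable_dyadic_time[OF T n] .
  have [measurable]: "G \<in> borel_measurable (PiM UNIV (\<lambda>_. borel))"
    unfolding G_def[abs_def] by measurable
  have G: "G (\<lambda>t. C (max s t) \<omega>) = F (brownian_prefix C T y n \<omega>) *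
      indicator {s..<s'} (brownian_time C T y n \<omega>)"
    if "continuous_on {0..} (\<lambda>t. C t \<omega>)" for C :: "real \<Rightarrow> 'b \<Rightarrow> 'a" and \<omega>
    using frozen_time_iff[where C = C and \<omega> = \<omega> and y = y and n = n, OF T less_imp_le[OF s] that]
      frozen_time_eq[where C = C and \<omega> = \<omega> and y = y and n = n, OF T less_imp_le[OF s] that]
      frozen_prefix_eq[where C = C and \<omega> = \<omega> and y = y and n = n, OF T less_imp_le[OF s] that]
    by (auto simp: G_def indicator_def)
  have "(\<integral>\<^sup>+\<omega>. ennreal (gauss_tilt s v (B s \<omega>)) *
      (F (brownian_prefix B T y n \<omega>) * indicator {s..<s'} (brownian_time B T y n \<omega>)) \<partial>M) =
    (\<integral>\<^sup>+\<omega>. ennreal (gauss_tilt s v (B s \<omega>)) * G (\<lambda>t. B (max s t) \<omega>) \<partial>M)"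
    using brownian_continuous[OF bm] by (intro nn_integral_cong) (simp add: G)
  also have "\<dots> = (\<integral>\<^sup>+\<omega>. G (\<lambda>t. B (max s t) \<omega> + v) \<partial>M)"
    by (rule nn_integral_brownian_path_tilt[OF bm s]) simp
  also have "\<dots> = (\<integral>\<^sup>+\<omega>. F (brownian_prefix B T (y + v) n \<omega>) *
      indicator {s..<s'} (brownian_time B T (y + v) n \<omega>) \<partial>M)"
  proof (intro nn_integral_cong)
    fix \<omega> assume "\<omega> \<in> space M"
    from brownian_continuous[OF bm this]
    have "continuous_on {0..} (\<lambda>t. (\<lambda>t \<omega>. B t \<omega> + v) t \<omega>)" by (intro continuous_intros)
    from G[where C = "\<lambda>t \<omega>. B t \<omega> + v", OF this]
    show "G (\<lambda>t. B (max s t) \<omega> + v) = F (brownian_prefix B T (y + v) n \<omega>) *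
        indicator {s..<s'} (brownian_time B T (y + v) n \<omega>)"
      by (simp add: brownian_prefix_shift brownian_time_shift)
  qed
  finally show ?thesis .
qed

text \<open>The density at the random time is the limit of its values at the lower ends of dyadic
  cells. Each approximation has integral at most the right-hand side, and Fatou's lemma keeps this
  bound.\<close>

lemma nn_integral_brownian_output_tilt:
  fixes y :: "'a::euclidean_space"
  assumes T: "time_functions T" and bm: "brownian_motion M B" and n: "1 \<le> n"
    and [measurable]: "F \<in> borel_measurable (PiM {1..n} (\<lambda>_. borel))"
  defines "\<tau> \<equiv> brownian_time B T y n"
  shows "(\<integral>\<^sup>+\<omega>. ennreal (gauss_tilt (\<tau> \<omega>) v (B (\<tau> \<omega>) \<omega>)) * F (brownian_prefix B T y n \<omega>) \<partial>M) \<le>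
    (\<integral>\<^sup>+\<omega>. F (brownian_prefix B T (y + v) n \<omega>) \<partial>M)"
proof -
  \<comment> \<open>With \<open>Suc j\<close> in place of \<open>j\<close> every lower end is
    positive, so the tilt there is meaningful. The part below \<open>1 / 2 ^ k\<close> is left out,
    which an upper bound permits.\<close>
  define s where "s k j = real (Suc j) / 2 ^ k" for k j
  define A where "A k j = {s k j..<s k (Suc j)}" for k j
  have A: "x \<in> A k j \<longleftrightarrow> \<lfloor>2 ^ k * x\<rfloor> = int (Suc j)" for k j x
    by (simp add: A_def s_def floor_eq_iff field_simps)
  have disj: "disjoint_family (A k)" for k
    by (auto simp: disjoint_family_on_def A)
  have s: "0 < s k j" for k j by (simp add: s_def)
  have [measurable]:
    "brownian_prefix B T y n \<in> measurable M (PiM {1..n} (\<lambda>_. borel))" for y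
    by (rule measurable_brownian_prefix[OF T bm])
  have [measurable]: "brownian_time B T y n \<in> borel_measurable M" for y
    by (rule measurable_brownian_time[OF T bm n])
  have [measurable]: "B (s k j) \<in> borel_measurable M" for k j
    using brownian_measurable[OF bm] s[of k j] by simp
  have [measurable]: "A k j \<in> sets borel" for k j by (simp add: A_def)
  have [measurable]: "\<tau> \<in> borel_measurable M" by (simp add: \<tau>_def)
  define h where "h k \<omega> = (\<Sum>j. ennreal (gauss_tilt (s k j) v (B (s k j) \<omega>)) *
    (F (brownian_prefix B T y n \<omega>) * indicator (A k j) (\<tau> \<omega>)))" for k \<omega>
  have [measurable]: "h k \<in> borel_measurable M" for k
    unfolding h_def[abs_def] by measurable
  have h_le: "(\<integral>\<^sup>+\<omega>. h k \<omega> \<partial>M) \<le> (\<integral>\<^sup>+\<omega>. F (brownian_prefix B T (y + v) n \<omega>) \<partial>M)" for k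
  proof -
    have "(\<integral>\<^sup>+\<omega>. h k \<omega> \<partial>M) = (\<Sum>j. \<integral>\<^sup>+\<omega>. ennreal (gauss_tilt (s k j) v (B (s k j) \<omega>)) *
        (F (brownian_prefix B T y n \<omega>) * indicator (A k j) (\<tau> \<omega>)) \<partial>M)"
      unfolding h_def by (rule nn_integral_suminf) measurable
    also have "\<dots> = (\<Sum>j. \<integral>\<^sup>+\<omega>. F (brownian_prefix B T (y + v) n \<omega>) *
        indicator (A k j) (brownian_time B T (y + v) n \<omega>) \<partial>M)"
      unfolding A_def \<tau>_def by (intro suminf_cong nn_integral_brownian_cell_tilt[OF T bm n s]) fact
    also have "\<dots> = (\<integral>\<^sup>+\<omega>. (\<Sum>j. F (brownian_prefix B T (y + v) n \<omega>) *
        indicator (A k j) (brownian_time B T (y + v) n \<omega>)) \<partial>M)"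
      by (rule nn_integral_suminf[symmetric]) measurable
    \<comment> \<open>The cells are disjoint, so at most one summand survives, and none if the time
      is below \<open>1 / 2 ^ k\<close>.\<close>
    also have "\<dots> \<le> (\<integral>\<^sup>+\<omega>. F (brownian_prefix B T (y + v) n \<omega>) \<partial>M)"
      by (rule nn_integral_mono)
        (auto simp: suminf_indicator[OF disj] split: split_indicator)
    finally show ?thesis .
  qed
  have lim: "(\<lambda>k. h k \<omega>) \<longlonglongrightarrow>
      ennreal (gauss_tilt (\<tau> \<omega>) v (B (\<tau> \<omega>) \<omega>)) * F (brownian_prefix B T y n \<omega>)"
    if \<omega>: "\<omega> \<in> space M" for \<omega>
  proof -
    have \<tau>: "0 < \<tau> \<omega>" unfolding \<tau>_def by (rule brownian_time_pos[OF T n])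
    define r where "r k = of_int \<lfloor>2 ^ k * \<tau> \<omega>\<rfloor> / (2 ^ k :: real)" for k
    have r: "r \<longlonglongrightarrow> \<tau> \<omega>" unfolding r_def by (rule dyadic_floor_tendsto)
    have "(\<lambda>k. B (r k) \<omega>) \<longlonglongrightarrow> B (\<tau> \<omega>) \<omega>"
      by (rule continuous_on_nonneg_tendsto[OF brownian_continuous[OF bm \<omega>] _ _ r])
        (use \<tau> in \<open>auto simp: r_def\<close>)
    then have "(\<lambda>k. gauss_tilt (r k) v (B (r k) \<omega>)) \<longlonglongrightarrow> gauss_tilt (\<tau> \<omega>) v (B (\<tau> \<omega>) \<omega>)"
      unfolding gauss_tilt_def using r \<tau> by (intro tendsto_intros) auto
    \<comment> \<open>The limit of the tilt is positive and finite, so multiplication is continuous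
      there even where \<open>F\<close> is infinite.\<close>
    then have "(\<lambda>k. ennreal (gauss_tilt (r k) v (B (r k) \<omega>)) * F (brownian_prefix B T y n \<omega>)) \<longlonglongrightarrow>
        ennreal (gauss_tilt (\<tau> \<omega>) v (B (\<tau> \<omega>) \<omega>)) * F (brownian_prefix B T y n \<omega>)"
      by (intro tendsto_mult_ennreal tendsto_ennrealI tendsto_const)
        (auto simp: gauss_tilt_def ennreal_eq_0_iff)
    \<comment> \<open>Once \<open>2 ^ k * \<tau> \<omega>\<close> is at least 1, the time lies in
      exactly one cell; its lower end is \<open>r k\<close>, and the series reduces to that
      term.\<close>
    moreover have "\<forall>\<^sub>F k in sequentially. ennreal (gauss_tilt (r k) v (B (r k) \<omega>)) *
        F (brownian_prefix B T y n \<omega>) = h k \<omega>"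
      using order_tendstoD(1)[OF r \<tau>]
    proof eventually_elim
      fix k assume "0 < r k"
      then have "0 < \<lfloor>2 ^ k * \<tau> \<omega>\<rfloor>" by (simp add: r_def zero_less_divide_iff)
      then obtain j where j: "\<lfloor>2 ^ k * \<tau> \<omega>\<rfloor> = int (Suc j)"
        using zero_less_imp_eq_int by (metis Suc_pred of_nat_0_less_iff)
      then have "\<tau> \<omega> \<in> A k j" "r k = s k j" by (simp_all add: A r_def s_def)
      with suminf_cmult_indicator[OF disj this(1),
          where f = "\<lambda>j. ennreal (gauss_tilt (s k j) v (B (s k j) \<omega>)) * F (brownian_prefix B T y n \<omega>)"]
      show "ennreal (gauss_tilt (r k) v (B (r k) \<omega>)) * F (brownian_prefix B T y n \<omega>) = h k \<omega>"
        by (simp add: h_def mult.assoc)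
    qed
    ultimately show ?thesis by (rule Lim_transform_eventually)
  qed
  have "(\<integral>\<^sup>+\<omega>. ennreal (gauss_tilt (\<tau> \<omega>) v (B (\<tau> \<omega>) \<omega>)) * F (brownian_prefix B T y n \<omega>) \<partial>M) =
    (\<integral>\<^sup>+\<omega>. liminf (\<lambda>k. h k \<omega>) \<partial>M)"
    by (intro nn_integral_cong lim_imp_Liminf[symmetric] lim) simp_all
  also have "\<dots> \<le> liminf (\<lambda>k. \<integral>\<^sup>+\<omega>. h k \<omega> \<partial>M)"
    by (rule nn_integral_liminf) simp
  also have "\<dots> \<le> (\<integral>\<^sup>+\<omega>. F (brownian_prefix B T (y + v) n \<omega>) \<partial>M)"
    using h_le by (intro Liminf_le) (auto intro!: always_eventually)
  finally show ?thesis .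
qed

text \<open>The domination says that the law of \<open>Y\<close> is at least \<open>r\<close> times
  the law of \<open>X\<close>. Tested on the set where \<open>q < p * r\<close>, it forces this set
  to be null, so \<open>p / q\<close> is at most \<open>1 / r\<close> along
  \<open>X\<close>.\<close>

lemma privacy_loss_le:
  assumes M: "prob_space M"
    and [measurable]: "X \<in> measurable M N" "Y \<in> measurable M N" "r \<in> borel_measurable N"
    and L: "privacy_loss M N X Y L" and r_pos: "\<And>z. 0 < r z"
    and dom: "\<And>S. S \<in> sets N \<Longrightarrow>
      (\<integral>\<^sup>+\<omega>. ennreal (r (X \<omega>)) * indicator S (X \<omega>) \<partial>M) \<le> (\<integral>\<^sup>+\<omega>. indicator S (Y \<omega>) \<partial>M)"
  shows "AE \<omega> in M. L \<omega> \<le> ereal (- ln (r (X \<omega>)))"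
proof -
  interpret prob_space M by (rule M)
  obtain \<mu> p q where [measurable]: "p \<in> borel_measurable \<mu>" "q \<in> borel_measurable \<mu>"
    and p: "\<And>z. 0 \<le> p z" and q: "\<And>z. 0 \<le> q z"
    and X: "distr M N X = density \<mu> (\<lambda>z. ennreal (p z))"
    and Y: "distr M N Y = density \<mu> (\<lambda>z. ennreal (q z))"
    and L_eq: "AE \<omega> in M. L \<omega> = (if q (X \<omega>) = 0 then \<infinity> else ereal (ln (p (X \<omega>) / q (X \<omega>))))"
    using L unfolding privacy_loss_def by blast
  have sets[measurable_cong, simp]: "sets \<mu> = sets N"
    using arg_cong[OF X, of sets] by simp
  define S where "S = {z \<in> space \<mu>. q z < p z * r z}"
  have S[measurable]: "S \<in> sets \<mu>" unfolding S_def by measurable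
  have "(\<integral>\<^sup>+z. ennreal (q z) * indicator S z \<partial>\<mu>) + (\<integral>\<^sup>+z. ennreal (p z * r z - q z) * indicator S z \<partial>\<mu>) =
    (\<integral>\<^sup>+z. ennreal (p z) * (ennreal (r z) * indicator S z) \<partial>\<mu>)"
    using p q r_pos
    by (subst nn_integral_add[symmetric])
      (auto intro!: nn_integral_cong split: split_indicator simp: S_def less_imp_le
        simp flip: ennreal_plus ennreal_mult)
  also have "\<dots> = (\<integral>\<^sup>+z. ennreal (r z) * indicator S z \<partial>distr M N X)"
    unfolding X by (simp add: nn_integral_density)
  also have "\<dots> = (\<integral>\<^sup>+\<omega>. ennreal (r (X \<omega>)) * indicator S (X \<omega>) \<partial>M)"
    by (simp add: nn_integral_distr)
  also have "\<dots> \<le> (\<integral>\<^sup>+\<omega>. indicator S (Y \<omega>) \<partial>M)"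
    using dom S by simp
  also have "\<dots> = (\<integral>\<^sup>+z. indicator S z \<partial>distr M N Y)"
    by (simp add: nn_integral_distr del: nn_integral_indicator)
  also have "\<dots> = (\<integral>\<^sup>+z. ennreal (q z) * indicator S z \<partial>\<mu>)"
    unfolding Y by (simp add: nn_integral_density del: nn_integral_indicator)
  finally have le: "(\<integral>\<^sup>+z. ennreal (q z) * indicator S z \<partial>\<mu>) +
      (\<integral>\<^sup>+z. ennreal (p z * r z - q z) * indicator S z \<partial>\<mu>) \<le>
    0 + (\<integral>\<^sup>+z. ennreal (q z) * indicator S z \<partial>\<mu>)" by simp
  \<comment> \<open>This integral is a probability, hence finite, and can be cancelled from both
    sides of the inequality.\<close>
  have "(\<integral>\<^sup>+z. ennreal (q z) * indicator S z \<partial>\<mu>) = emeasure (distr M N Y) S"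
    unfolding Y using S by (simp add: emeasure_density)
  also have "\<dots> < top"
    using S by (simp add: emeasure_distr less_top[symmetric])
  finally have "(\<integral>\<^sup>+z. ennreal (p z * r z - q z) * indicator S z \<partial>\<mu>) = 0"
    using le by (auto simp: add.commute ennreal_add_left_cancel_le)
  then have "AE z in \<mu>. \<not> q z < p z * r z"
    by (subst (asm) nn_integral_0_iff_AE)
      (auto simp: S_def split: split_indicator_asm elim!: eventually_mono)
  \<comment> \<open>Under the law of \<open>X\<close> the density \<open>p\<close> is positive; the
    inequality then makes \<open>q\<close> positive as well and rules out the infinite branch of the
    loss.\<close>
  then have "AE z in distr M N X. 0 < p z \<and> p z * r z \<le> q z"
    unfolding X by (subst AE_density) (auto elim!: eventually_mono)
  then have "AE \<omega> in M. 0 < p (X \<omega>) \<and> p (X \<omega>) * r (X \<omega>) \<le> q (X \<omega>)"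
    by (rule AE_distrD[rotated]) simp
  with L_eq show ?thesis
  proof eventually_elim
    case (elim \<omega>)
    have "0 < p (X \<omega>) * r (X \<omega>)" using elim r_pos by simp
    with elim have q: "0 < q (X \<omega>)" by linarith
    with elim r_pos[of "X \<omega>"] have "p (X \<omega>) / q (X \<omega>) \<le> 1 / r (X \<omega>)"
      by (simp add: field_simps)
    then have "ln (p (X \<omega>) / q (X \<omega>)) \<le> ln (1 / r (X \<omega>))"
      using elim q r_pos by (subst ln_le_cancel_iff) auto
    also have "\<dots> = - ln (r (X \<omega>))" using r_pos by (simp add: ln_div)
    finally show ?case using elim q by simp
  qed
qed

lemma brownian_privacy_loss_le:
  fixes y :: "'a::euclidean_space"
  assumes T: "time_functions T" and bm: "brownian_motion M B" and n: "1 \<le> n"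
    and L: "privacy_loss M (PiM {1..n} (\<lambda>_. borel))
      (brownian_prefix B T y n) (brownian_prefix B T (y + v) n) L"
  defines "\<tau> \<equiv> brownian_time B T y n"
  shows "AE \<omega> in M. L \<omega> \<le> ereal ((v \<bullet> v / 2 - B (\<tau> \<omega>) \<omega> \<bullet> v) / \<tau> \<omega>)"
proof -
  \<comment> \<open>The tilt as a function of the output alone: the first \<open>n - 1\<close>
    coordinates determine the time, and the last one minus \<open>y\<close> is the Brownian motion
    at that time.\<close>
  define r where "r \<beta> = gauss_tilt (T n (restrict \<beta> {1..<n})) v (\<beta> n - y)" for \<beta> :: "nat \<Rightarrow> 'a"
  have [measurable]: "T n \<in> borel_measurable (PiM {1..<n} (\<lambda>_. borel))"
    using T n by (simp add: time_functions_def)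
  have [measurable]: "(\<lambda>\<beta>. restrict \<beta> {1..<n}) \<in>
      measurable (PiM {1..n} (\<lambda>_. borel :: 'a measure)) (PiM {1..<n} (\<lambda>_. borel))"
    by (rule measurable_restrict_subset) auto
  have [measurable]: "(\<lambda>\<beta>. \<beta> n) \<in> borel_measurable (PiM {1..n} (\<lambda>_. borel :: 'a measure))"
    using n by (intro measurable_component_singleton) auto
  have r[measurable]: "r \<in> borel_measurable (PiM {1..n} (\<lambda>_. borel))"
    unfolding r_def[abs_def] by measurable
  have "restrict (brownian_prefix B T y n \<omega>) {1..<n} =
      (\<lambda>i\<in>{1..<n}. brownian_mechanism B T y i \<omega>)" for \<omega>
    by (auto simp: brownian_prefix_def)
  then have "T n (restrict (brownian_prefix B T y n \<omega>) {1..<n}) = \<tau> \<omega>" for \<omega>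
    by (simp only: \<tau>_def brownian_time_def)
  moreover have "brownian_prefix B T y n \<omega> n - y = B (\<tau> \<omega>) \<omega>" for \<omega>
    using n by (simp add: brownian_prefix_def brownian_mechanism_eq \<tau>_def)
  ultimately have r_eq: "r (brownian_prefix B T y n \<omega>) = gauss_tilt (\<tau> \<omega>) v (B (\<tau> \<omega>) \<omega>)" for \<omega>
    by (simp only: r_def)
  have "AE \<omega> in M. L \<omega> \<le> ereal (- ln (r (brownian_prefix B T y n \<omega>)))"
  proof (rule privacy_loss_le[OF brownian_prob_space[OF bm]
        measurable_brownian_prefix[OF T bm] measurable_brownian_prefix[OF T bm] r L])
    fix S assume [measurable]: "S \<in> sets (PiM {1..n} (\<lambda>_. borel :: 'a measure))"
    show "(\<integral>\<^sup>+\<omega>. ennreal (r (brownian_prefix B T y n \<omega>)) * indicator S (brownian_prefix B T y n \<omega>) \<partial>M) \<le>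
      (\<integral>\<^sup>+\<omega>. indicator S (brownian_prefix B T (y + v) n \<omega>) \<partial>M)"
      unfolding r_eq \<tau>_def by (rule nn_integral_brownian_output_tilt[OF T bm n]) measurable
  qed (simp add: r_def gauss_tilt_def)
  then show ?thesis
    by (simp add: r_eq gauss_tilt_def diff_divide_distrib)
qed

section \<open>A maximal inequality\<close>

lemma prob_space_gauss:
  assumes "0 < t"
  shows "prob_space (density lborel (gauss t :: 'a::euclidean_space \<Rightarrow> real))"
proof
  have 1: "(\<integral>\<^sup>+x. ennreal (normal_density 0 (sqrt t) x) \<partial>lborel) = 1"
    using prob_space.emeasure_space_1[OF prob_space_normal_density[of "sqrt t" 0]] assms
    by (simp add: emeasure_density)
  have "(\<integral>\<^sup>+z. ennreal (gauss t z) \<partial>(lborel :: 'a measure)) =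
    (\<integral>\<^sup>+z. (\<Prod>b\<in>Basis. ennreal (normal_density 0 (sqrt t) (z \<bullet> b))) \<partial>(lborel :: 'a measure))"
    by (simp add: gauss_def prod_ennreal)
  also have "\<dots> = 1" by (subst nn_integral_lborel_prod) (simp_all add: 1)
  finally show "emeasure (density lborel (gauss t :: 'a \<Rightarrow> real))
      (space (density lborel (gauss t :: 'a \<Rightarrow> real))) = 1"
    by (simp add: emeasure_density)
qed

text \<open>Ville's inequality on a grid: \<open>super\<close> makes \<open>h\<close> along the path
  a nonnegative supermartingale, which is stopped at its first passage above \<open>c\<close>.
  Subtracting \<open>B 0\<close> makes the process a sum of increments everywhere, since
  \<open>B 0\<close> vanishes only almost surely.\<close>

lemma brownian_maximal_grid:
  fixes B :: "real \<Rightarrow> 'w \<Rightarrow> 'a::euclidean_space" and h :: "real \<Rightarrow> 'a \<Rightarrow> ennreal"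
  assumes bm: "brownian_motion M B"
    and h[measurable]: "\<And>t. 0 \<le> t \<Longrightarrow> h t \<in> borel_measurable borel"
    and super: "\<And>t r z. 0 \<le> t \<Longrightarrow> 0 < r \<Longrightarrow>
      (\<integral>\<^sup>+x. h (t + r) (z + x) \<partial>density lborel (gauss r)) \<le> h t z"
    and \<tau>: "strict_mono \<tau>" "\<tau> 0 = 0"
  shows "c * emeasure M {\<omega> \<in> space M. \<exists>j\<le>m::nat. c < h (\<tau> j) (B (\<tau> j) \<omega> - B 0 \<omega>)} \<le> h 0 0"
proof -
  interpret prob_space M by (rule brownian_prob_space[OF bm])
  have \<tau>_nonneg: "0 \<le> \<tau> j" for j using \<tau> by (metis strict_mono_less_eq zero_le)
  have [measurable]: "B (\<tau> j) \<in> borel_measurable M" "h (\<tau> j) \<in> borel_measurable borel" for j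
    using brownian_measurable[OF bm] h \<tau>_nonneg by auto
  have [measurable]: "B 0 \<in> borel_measurable M" by (simp add: brownian_measurable[OF bm])
  define X where "X i \<omega> = B (\<tau> (Suc i)) \<omega> - B (\<tau> i) \<omega>" for i \<omega>
  have [measurable]: "X i \<in> borel_measurable M" for i unfolding X_def by measurable
  define W where "W j x = (\<Sum>i<j. x i)" for j and x :: "nat \<Rightarrow> 'a"
  define hit where "hit m x \<longleftrightarrow> (\<exists>j\<le>m. c < h (\<tau> j) (W j x))" for m x
  \<comment> \<open>The stopped process, with its value lowered to \<open>c\<close> from the first
    passage on. Its expectation never exceeds \<open>h 0 0\<close>, and it is at least
    \<open>c\<close> on every path that has passed.\<close>
  define U where "U m x = (if hit m x then c else h (\<tau> m) (W m x))" for m x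
  have W_X: "W j (\<lambda>i. X i \<omega>) = B (\<tau> j) \<omega> - B 0 \<omega>" for j \<omega>
    using sum_lessThan_telescope[of "\<lambda>i. B (\<tau> i) \<omega>" j] by (simp add: W_def X_def \<tau>)
  have [measurable]: "(\<lambda>\<omega>. U m (\<lambda>i. X i \<omega>)) \<in> borel_measurable M" for m
    unfolding U_def hit_def W_def by measurable
  have "(\<integral>\<^sup>+\<omega>. U m (\<lambda>i. X i \<omega>) \<partial>M) \<le> h 0 0" for m
  proof (induction m)
    case 0
    have "U 0 x \<le> h 0 0" for x by (auto simp: U_def hit_def W_def \<tau>)
    then have "(\<integral>\<^sup>+\<omega>. U 0 (\<lambda>i. X i \<omega>) \<partial>M) \<le> (\<integral>\<^sup>+\<omega>. h 0 0 \<partial>M)" by (intro nn_integral_mono)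
    then show ?case by (simp add: emeasure_space_1)
  next
    case (Suc m)
    define G where "G x y = (if hit m x then c else h (\<tau> (Suc m)) (W m x + y))" for x y
    have W[measurable]: "W j \<in> borel_measurable (PiM {..<m} (\<lambda>_. borel))" if "j \<le> m" for j
    proof -
      have [measurable]: "(\<lambda>x. x i) \<in> borel_measurable (PiM {..<m} (\<lambda>_. borel :: 'a measure))"
        if "i \<in> {..<j}" for i
        using that \<open>j \<le> m\<close> by (intro measurable_component_singleton) auto
      show ?thesis unfolding W_def[abs_def] by measurable
    qed
    have [measurable]: "Measurable.pred (PiM {..<m} (\<lambda>_. borel)) (\<lambda>x. c < h (\<tau> j) (W j x))"
      if "j \<in> {..m}" for j
    proof -
      have [measurable]: "W j \<in> borel_measurable (PiM {..<m} (\<lambda>_. borel))"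
        using that by (intro W) simp
      show ?thesis by measurable
    qed
    have "Measurable.pred (PiM {..<m} (\<lambda>_. borel)) (\<lambda>x. \<exists>j\<in>{..m}. c < h (\<tau> j) (W j x))"
      by measurable
    then have [measurable]: "Measurable.pred (PiM {..<m} (\<lambda>_. borel)) (hit m)"
      by (simp add: hit_def[abs_def] Bex_def)
    have [measurable]: "W m \<in> borel_measurable (PiM {..<m} (\<lambda>_. borel))" by (rule W) simp
    have G: "case_prod G \<in> borel_measurable (PiM {..<m} (\<lambda>_. borel) \<Otimes>\<^sub>M borel)"
      unfolding G_def case_prod_beta by measurable
    have W_restrict: "W j (\<lambda>i\<in>{..<m}. x i) = W j x" if "j \<le> m" for j x
      unfolding W_def by (rule sum.cong) (use that in auto)
    then have hit_restrict: "hit m (\<lambda>i\<in>{..<m}. x i) \<longleftrightarrow> hit m x" for x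
      by (auto simp: hit_def)
    \<comment> \<open>\<open>G\<close> checks for a passage only up to step \<open>m\<close>. If the
      passage happens at step \<open>m + 1\<close>, then \<open>U\<close> is \<open>c\<close> while
      \<open>G\<close> is the larger value of \<open>h\<close>.\<close>
    have "U (Suc m) x \<le> G (\<lambda>i\<in>{..<m}. x i) (x m)" for x
      by (auto simp: U_def G_def hit_restrict W_restrict hit_def le_Suc_eq)
        (auto simp: W_def)
    then have "(\<integral>\<^sup>+\<omega>. U (Suc m) (\<lambda>i. X i \<omega>) \<partial>M) \<le>
        (\<integral>\<^sup>+\<omega>. G (\<lambda>i\<in>{..<m}. X i \<omega>) (X m \<omega>) \<partial>M)"
      by (intro nn_integral_mono)
    also have "\<dots> = (\<integral>\<^sup>+\<omega>. (\<integral>\<^sup>+y. G (\<lambda>i\<in>{..<m}. X i \<omega>) y \<partial>distr M borel (X m)) \<partial>M)"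
      by (rule nn_integral_indep_vars_component[where I = "{..<Suc m}" and N = "\<lambda>_. borel", OF _ _ _ _ G])
        (use brownian_increments[OF bm, of \<tau> "Suc m"] \<tau> in \<open>auto simp: X_def[abs_def] strict_mono_mono\<close>)
    also have "\<dots> \<le> (\<integral>\<^sup>+\<omega>. U m (\<lambda>i. X i \<omega>) \<partial>M)"
    proof (rule nn_integral_mono)
      fix \<omega>
      define r where "r = \<tau> (Suc m) - \<tau> m"
      have r: "0 < r" using \<tau> by (simp add: r_def strict_mono_less)
      interpret g: prob_space "density lborel (gauss r :: 'a \<Rightarrow> real)"
        by (rule prob_space_gauss[OF r])
      have law: "distr M borel (X m) = density lborel (gauss r)"
        unfolding X_def[abs_def] r_def
        by (rule distr_brownian_increment[OF bm \<tau>_nonneg]) (use \<tau> in \<open>simp add: strict_mono_less\<close>)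
      have "(\<integral>\<^sup>+y. h (\<tau> m + r) (W m (\<lambda>i. X i \<omega>) + y) \<partial>density lborel (gauss r)) \<le>
          h (\<tau> m) (W m (\<lambda>i. X i \<omega>))"
        by (rule super[OF \<tau>_nonneg r])
      then show "(\<integral>\<^sup>+y. G (\<lambda>i\<in>{..<m}. X i \<omega>) y \<partial>distr M borel (X m)) \<le> U m (\<lambda>i. X i \<omega>)"
        using g.emeasure_space_1
        by (auto simp: law G_def U_def hit_restrict W_restrict r_def)
    qed
    also have "\<dots> \<le> h 0 0" by (rule Suc.IH)
    finally show ?case .
  qed
  note U_le = this
  have "c * emeasure M {\<omega> \<in> space M. hit m (\<lambda>i. X i \<omega>)} =
      (\<integral>\<^sup>+\<omega>. c * indicator {\<omega> \<in> space M. hit m (\<lambda>i. X i \<omega>)} \<omega> \<partial>M)"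
    by (subst nn_integral_cmult_indicator) (simp_all add: hit_def W_def)
  also have "\<dots> \<le> (\<integral>\<^sup>+\<omega>. U m (\<lambda>i. X i \<omega>) \<partial>M)"
    by (intro nn_integral_mono) (auto simp: U_def split: split_indicator)
  finally show ?thesis
    using U_le[of m] by (simp add: hit_def W_X)
qed

text \<open>Ville's inequality in continuous time, from the grid version on finer grids with longer
  horizons. \<open>E\<close> is any measurable set almost surely contained in the crossing event, so
  measurability of that event is never at issue.\<close>

lemma brownian_maximal_inequality:
  fixes B :: "real \<Rightarrow> 'w \<Rightarrow> 'a::euclidean_space" and h :: "real \<Rightarrow> 'a \<Rightarrow> real"
  assumes bm: "brownian_motion M B"
    and h_nonneg: "\<And>t z. 0 \<le> t \<Longrightarrow> 0 \<le> h t z"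
    and h_cont: "continuous_on ({0..} \<times> UNIV) (\<lambda>(t, z). h t z)"
    and super: "\<And>t r z. 0 \<le> t \<Longrightarrow> 0 < r \<Longrightarrow>
      (\<integral>\<^sup>+x. ennreal (h (t + r) (z + x)) \<partial>density lborel (gauss r)) \<le> ennreal (h t z)"
    and a: "0 < a" and E: "E \<in> sets M" "AE \<omega> in M. \<omega> \<in> E \<longrightarrow> (\<exists>t\<ge>0. a \<le> h t (B t \<omega>))"
  shows "measure M E \<le> h 0 0 / a"
proof -
  interpret prob_space M by (rule brownian_prob_space[OF bm])
  have h: "h t \<in> borel_measurable borel" if "0 \<le> t" for t
    using that by (intro borel_measurable_continuous_onI continuous_on_compose2[OF h_cont, of UNIV "Pair t", simplified])
      (auto intro!: continuous_intros)
  have [measurable]: "B 0 \<in> borel_measurable M" by (simp add: brownian_measurable[OF bm])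
  \<comment> \<open>By continuity, a path that reaches level \<open>a\<close> exceeds any lower
    level \<open>c\<close> at nearby grid points; the strict gap survives the passage to the
    grid.\<close>
  have bound: "c * measure M E \<le> h 0 0" if c: "0 < c" "c < a" for c
  proof -
    \<comment> \<open>Mesh \<open>1 / 2 ^ k\<close> with indices up to \<open>4 ^ k\<close> gives
      horizon \<open>2 ^ k\<close>. The grids are nested through \<open>j\<close> going to
      \<open>2 * j\<close>, and they eventually cover every bounded time interval.\<close>
    define A where "A k = {\<omega> \<in> space M. \<exists>j\<le>4 ^ k. c < h (real j / 2 ^ k) (B (real j / 2 ^ k) \<omega> - B 0 \<omega>)}"
      for k :: nat
    have A[measurable]: "A k \<in> sets M" for k
    proof -
      have [measurable]: "B (real j / 2 ^ k) \<in> borel_measurable M"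
        "h (real j / 2 ^ k) \<in> borel_measurable borel" for j
        using brownian_measurable[OF bm] h by auto
      show ?thesis unfolding A_def by measurable
    qed
    have A_le: "ennreal c * emeasure M (A k) \<le> ennreal (h 0 0)" for k
    proof -
      have "A k = {\<omega> \<in> space M. \<exists>j\<le>4 ^ k. ennreal c <
          ennreal (h (real j / 2 ^ k) (B (real j / 2 ^ k) \<omega> - B 0 \<omega>))}"
        using c h_nonneg by (simp add: A_def ennreal_less_iff)
      then show ?thesis
        using brownian_maximal_grid[OF bm, of "\<lambda>t z. ennreal (h t z)" "\<lambda>j. real j / 2 ^ k" "ennreal c" "4 ^ k"]
          super h by (simp add: strict_mono_def divide_strict_right_mono)
    qed
    have "incseq A"
    proof (rule incseq_SucI, rule subsetI)
      fix k \<omega> assume "\<omega> \<in> A k"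
      then obtain j where j: "j \<le> 4 ^ k" "\<omega> \<in> space M"
        "c < h (real j / 2 ^ k) (B (real j / 2 ^ k) \<omega> - B 0 \<omega>)"
        by (auto simp: A_def)
      moreover have "real (2 * j) / 2 ^ Suc k = real j / 2 ^ k" by simp
      ultimately have "2 * j \<le> 4 ^ Suc k"
        "c < h (real (2 * j) / 2 ^ Suc k) (B (real (2 * j) / 2 ^ Suc k) \<omega> - B 0 \<omega>)"
        by simp_all
      with j(2) show "\<omega> \<in> A (Suc k)" unfolding A_def by blast
    qed
    have "AE \<omega> in M. \<omega> \<in> E \<longrightarrow> \<omega> \<in> (\<Union>k. A k)"
      using E(2) brownian_start[OF bm] AE_space
    proof (eventually_elim, safe)
      fix \<omega> t assume \<omega>: "\<omega> \<in> space M" "B 0 \<omega> = 0" and t: "0 \<le> t" "a \<le> h t (B t \<omega>)"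
      define r where "r k = real (nat \<lceil>2 ^ k * t\<rceil>) / 2 ^ k" for k
      have r_eq: "r k = of_int \<lceil>2 ^ k * t\<rceil> / 2 ^ k" for k
      proof -
        have "0 \<le> 2 ^ k * t" using t by simp
        then have "0 \<le> \<lceil>2 ^ k * t\<rceil>" by linarith
        then show ?thesis by (simp add: r_def)
      qed
      have r: "r \<longlonglongrightarrow> t"
        using dyadic_ceiling_tendsto[of t] unfolding r_eq[abs_def] .
      have r0: "0 \<le> r k" for k by (simp add: r_def)
      have "(\<lambda>k. B (r k) \<omega>) \<longlonglongrightarrow> B t \<omega>"
        by (rule continuous_on_nonneg_tendsto[OF brownian_continuous[OF bm \<omega>(1)] t(1) r0 r])
      with r have "(\<lambda>k. (r k, B (r k) \<omega>)) \<longlonglongrightarrow> (t, B t \<omega>)" by (rule tendsto_Pair)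
      from continuous_on_tendsto_compose[OF h_cont this]
      have "(\<lambda>k. h (r k) (B (r k) \<omega>)) \<longlonglongrightarrow> h t (B t \<omega>)" using t r0 by simp
      then have "\<forall>\<^sub>F k in sequentially. c < h (r k) (B (r k) \<omega>)"
        by (rule order_tendstoD) (use t c in linarith)
      moreover have "\<forall>\<^sub>F k in sequentially. r k < t + 1"
        by (rule order_tendstoD[OF r]) simp
      moreover obtain m where "t + 1 < 2 ^ m"
        using real_arch_pow[of 2 "t + 1"] by auto
      then have "\<forall>\<^sub>F k in sequentially. t + 1 < 2 ^ k"
        by (intro eventually_sequentiallyI[of m]) (auto intro: less_le_trans power_increasing)
      ultimately have "\<forall>\<^sub>F k in sequentially. \<omega> \<in> A k"
      proof eventually_elim
        case (elim k)
        then have "real (nat \<lceil>2 ^ k * t\<rceil>) / 2 ^ k \<le> 2 ^ k" by (simp add: r_def)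
        then have "real (nat \<lceil>2 ^ k * t\<rceil>) \<le> 2 ^ k * 2 ^ k" by (simp add: field_simps)
        also have "\<dots> = real (4 ^ k)" by (simp flip: power_mult_distrib)
        finally have "nat \<lceil>2 ^ k * t\<rceil> \<le> 4 ^ k" by linarith
        with elim \<omega> show ?case
          unfolding A_def by (intro CollectI conjI exI[of _ "nat \<lceil>2 ^ k * t\<rceil>"]) (simp_all add: r_def)
      qed
      then show "\<omega> \<in> (\<Union>k. A k)" by (auto dest: eventually_happens)
    qed
    then have "emeasure M E \<le> emeasure M (\<Union>k. A k)"
      using E(1) by (intro emeasure_mono_AE) auto
    also have "\<dots> = (SUP k. emeasure M (A k))"
      by (rule SUP_emeasure_incseq[symmetric]) (use \<open>incseq A\<close> in auto)
    finally have "ennreal c * emeasure M E \<le> ennreal c * (SUP k. emeasure M (A k))"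
      by (rule mult_left_mono) simp
    also have "\<dots> \<le> ennreal (h 0 0)"
      by (subst SUP_mult_left_ennreal) (auto intro: SUP_least A_le)
    finally show ?thesis
      using c h_nonneg by (simp add: emeasure_eq_measure flip: ennreal_mult)
  qed
  \<comment> \<open>Here \<open>c\<close> increases to \<open>a\<close>.\<close>
  have "a * measure M E \<le> h 0 0"
  proof (rule field_le_mult_one_interval)
    fix z :: real assume z: "0 < z" "z < 1"
    with bound[of "z * a"] a show "z * (a * measure M E) \<le> h 0 0" by simp
  qed
  then show ?thesis using a by (simp add: field_simps)
qed

section \<open>Boundary crossing and privacy boundaries\<close>

text \<open>Wald's exponential martingale with parameter \<open>l\<close> for the real Brownian
  motion in direction \<open>u\<close>, as a function of time and position.\<close>

definition exp_martingale :: "'a::euclidean_space \<Rightarrow> real \<Rightarrow> real \<Rightarrow> 'a \<Rightarrow> real" where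
  "exp_martingale u l t z = exp (l * (z \<bullet> u) - l\<^sup>2 * t / 2)"

text \<open>The exponential martingale integrated over \<open>l\<close> drawn from N(0, 1/\<rho>),
  in closed form.\<close>

definition mixture_martingale :: "'a::euclidean_space \<Rightarrow> real \<Rightarrow> real \<Rightarrow> 'a \<Rightarrow> real" where
  "mixture_martingale u \<rho> t z = sqrt (\<rho> / (t + \<rho>)) * exp ((z \<bullet> u)\<^sup>2 / (2 * (t + \<rho>)))"

text \<open>The multiplicative increment over a step of length \<open>r\<close> is the Gaussian tilt
  by \<open>(l * r) *\<^sub>R u\<close>, which has integral 1.\<close>

lemma nn_integral_exp_martingale:
  assumes r: "0 < r" and u: "norm u = 1"
  shows "(\<integral>\<^sup>+x. ennreal (exp_martingale u l (t + r) (z + x)) \<partial>density lborel (gauss r)) =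
    ennreal (exp_martingale u l t z)"
proof -
  interpret g: prob_space "density lborel (gauss r :: 'a \<Rightarrow> real)"
    by (rule prob_space_gauss[OF r])
  have "u \<bullet> u = 1" using u by (simp add: dot_square_norm)
  then have "exp_martingale u l (t + r) (z + x) =
      exp_martingale u l t z * gauss_tilt r ((l * r) *\<^sub>R u) x" for x
    using r unfolding exp_martingale_def gauss_tilt_def exp_add[symmetric]
    by (intro arg_cong[where f = exp]) (simp add: inner_add_left field_simps power2_eq_square)
  then have "(\<integral>\<^sup>+x. ennreal (exp_martingale u l (t + r) (z + x)) \<partial>density lborel (gauss r)) =
      ennreal (exp_martingale u l t z) *
      (\<integral>\<^sup>+x. ennreal (gauss_tilt r ((l * r) *\<^sub>R u) x) * 1 \<partial>density lborel (gauss r))"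
    by (simp add: ennreal_mult' exp_martingale_def nn_integral_cmult)
  also have "\<dots> = ennreal (exp_martingale u l t z)"
    using g.emeasure_space_1 by (subst nn_integral_gauss_tilt[OF r]) simp_all
  finally show ?thesis .
qed

text \<open>Completing the square in \<open>l\<close>. In Bayesian terms, the prior N(0, 1/\<rho>)
  has a normal posterior with variance \<open>1 / (t + \<rho>)\<close>, and the mixture is the
  normalising factor.\<close>

lemma exp_martingale_times_normal_density:
  assumes "0 < \<rho>" "0 \<le> t"
  shows "exp_martingale u l t z * normal_density 0 (1 / sqrt \<rho>) l =
    mixture_martingale u \<rho> t z * normal_density ((z \<bullet> u) / (t + \<rho>)) (1 / sqrt (t + \<rho>)) l"
proof -
  define w where "w = z \<bullet> u"
  define c where "c = t + \<rho>"
  have c: "0 < c" "t = c - \<rho>" using assms by (simp_all add: c_def)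
  have e: "l * w - l\<^sup>2 * t / 2 - \<rho> * l\<^sup>2 / 2 = w\<^sup>2 / (2 * c) - c * (l - w / c)\<^sup>2 / 2"
  proof -
    have "c * (l - w / c)\<^sup>2 = c * l\<^sup>2 - 2 * l * w + w\<^sup>2 / c"
      using c(1) by (simp add: field_simps power2_eq_square)
    then show ?thesis unfolding c(2) by (simp add: field_simps)
  qed
  have d: "normal_density \<mu> (1 / sqrt x) l = sqrt x / sqrt (2 * pi) * exp (- x * (l - \<mu>)\<^sup>2 / 2)"
    if "0 < x" for \<mu> x
    using that by (simp add: normal_density_def power_divide real_sqrt_divide field_simps)
  have "exp (l * w - l\<^sup>2 * t / 2) * exp (- \<rho> * l\<^sup>2 / 2) =
      exp (w\<^sup>2 / (2 * c)) * exp (- c * (l - w / c)\<^sup>2 / 2)"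
    unfolding exp_add[symmetric] using e by simp
  moreover have "sqrt (\<rho> / c) * sqrt c = sqrt \<rho>"
    using c by (simp add: real_sqrt_divide)
  ultimately have "sqrt \<rho> * (exp (l * w - l\<^sup>2 * t / 2) * exp (- \<rho> * l\<^sup>2 / 2)) =
      sqrt (\<rho> / c) * sqrt c * (exp (w\<^sup>2 / (2 * c)) * exp (- c * (l - w / c)\<^sup>2 / 2))"
    by (simp only:)
  then show ?thesis
    unfolding exp_martingale_def mixture_martingale_def w_def[symmetric] c_def[symmetric]
      d[OF assms(1)] d[OF c(1)]
    by (simp add: mult_ac)
qed

text \<open>The posterior density has mass 1 and the other factor is free of
  \<open>l\<close>.\<close>

lemma mixture_martingale_eq:
  assumes "0 < \<rho>" "0 \<le> t"
  shows "(\<integral>\<^sup>+l. ennreal (exp_martingale u l t z) * ennreal (normal_density 0 (1 / sqrt \<rho>) l) \<partial>lborel) =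
    ennreal (mixture_martingale u \<rho> t z)"
proof -
  have 1: "(\<integral>\<^sup>+l. ennreal (normal_density m s l) \<partial>lborel) = 1" if "0 < s" for m s
    using prob_space.emeasure_space_1[OF prob_space_normal_density[OF that, of m]]
    by (simp add: emeasure_density)
  have "(\<integral>\<^sup>+l. ennreal (exp_martingale u l t z) * ennreal (normal_density 0 (1 / sqrt \<rho>) l) \<partial>lborel) =
    (\<integral>\<^sup>+l. ennreal (mixture_martingale u \<rho> t z) *
      ennreal (normal_density ((z \<bullet> u) / (t + \<rho>)) (1 / sqrt (t + \<rho>)) l) \<partial>lborel)"
    by (intro nn_integral_cong)
      (simp add: exp_martingale_times_normal_density[OF assms] flip: ennreal_mult'')
  also have "\<dots> = ennreal (mixture_martingale u \<rho> t z)"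
    using assms by (simp add: nn_integral_cmult 1)
  finally show ?thesis .
qed

text \<open>Tonelli's theorem passes the martingale property from each parameter \<open>l\<close> to
  the mixture.\<close>

lemma nn_integral_mixture_martingale:
  assumes t: "0 \<le> t" and r: "0 < r" and \<rho>: "0 < \<rho>" and u: "norm u = 1"
  shows "(\<integral>\<^sup>+x. ennreal (mixture_martingale u \<rho> (t + r) (z + x)) \<partial>density lborel (gauss r)) =
    ennreal (mixture_martingale u \<rho> t z)"
proof -
  define d where "d l = ennreal (normal_density 0 (1 / sqrt \<rho>) l)" for l
  have [measurable]: "d \<in> borel_measurable borel" unfolding d_def[abs_def] by measurable
  interpret g: prob_space "density lborel (gauss r :: 'a \<Rightarrow> real)"
    by (rule prob_space_gauss[OF r])
  interpret pair_sigma_finite lborel "density lborel (gauss r :: 'a \<Rightarrow> real)" ..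
  have "(\<integral>\<^sup>+x. ennreal (mixture_martingale u \<rho> (t + r) (z + x)) \<partial>density lborel (gauss r)) =
    (\<integral>\<^sup>+x. (\<integral>\<^sup>+l. ennreal (exp_martingale u l (t + r) (z + x)) * d l \<partial>lborel) \<partial>density lborel (gauss r))"
    using t r \<rho> by (simp add: d_def mixture_martingale_eq)
  also have "\<dots> = (\<integral>\<^sup>+l. (\<integral>\<^sup>+x. ennreal (exp_martingale u l (t + r) (z + x)) * d l
      \<partial>density lborel (gauss r)) \<partial>lborel)"
    by (rule Fubini') (simp add: exp_martingale_def)
  also have "\<dots> = (\<integral>\<^sup>+l. ennreal (exp_martingale u l t z) * d l \<partial>lborel)"
  proof (rule nn_integral_cong)
    fix l
    have "(\<integral>\<^sup>+x. ennreal (exp_martingale u l (t + r) (z + x)) * d l \<partial>density lborel (gauss r)) =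
      (\<integral>\<^sup>+x. ennreal (exp_martingale u l (t + r) (z + x)) \<partial>density lborel (gauss r)) * d l"
      by (rule nn_integral_multc) (simp add: exp_martingale_def)
    then show "(\<integral>\<^sup>+x. ennreal (exp_martingale u l (t + r) (z + x)) * d l \<partial>density lborel (gauss r)) =
      ennreal (exp_martingale u l t z) * d l"
      by (simp add: nn_integral_exp_martingale[OF r u])
  qed
  also have "\<dots> = ennreal (mixture_martingale u \<rho> t z)"
    unfolding d_def by (rule mixture_martingale_eq[OF \<rho> t])
  finally show ?thesis .
qed

text \<open>The parameter \<open>2 * a\<close> is chosen so that on the line
  \<open>b + a * t\<close> the exponent is \<open>2 * a * b\<close> at every \<open>t\<close>; a
  crossing thus lifts the martingale from 1 to at least \<open>exp (2 * a * b)\<close>.\<close>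

lemma brownian_linear_crossing:
  fixes B :: "real \<Rightarrow> 'w \<Rightarrow> 'a::euclidean_space"
  assumes bm: "brownian_motion M B" and u: "norm u = 1" and a: "0 < a" and b: "0 < b"
    and E: "E \<in> sets M" "AE \<omega> in M. \<omega> \<in> E \<longrightarrow> (\<exists>t\<ge>0. b + a * t \<le> B t \<omega> \<bullet> u)"
  shows "measure M E \<le> exp (- 2 * a * b)"
proof -
  have "measure M E \<le> exp_martingale u (2 * a) 0 0 / exp (2 * a * b)"
  proof (rule brownian_maximal_inequality[OF bm, where h = "exp_martingale u (2 * a)"])
    show "continuous_on ({0..} \<times> UNIV) (\<lambda>(t, z). exp_martingale u (2 * a) t z)"
      unfolding exp_martingale_def case_prod_beta by (intro continuous_intros) auto
    show "AE \<omega> in M. \<omega> \<in> E \<longrightarrow> (\<exists>t\<ge>0. exp (2 * a * b) \<le> exp_martingale u (2 * a) t (B t \<omega>))"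
      using E(2)
    proof eventually_elim
      case (elim \<omega>)
      have "2 * a * b \<le> 2 * a * x - (2 * a)\<^sup>2 * t / 2" if "b + a * t \<le> x" for x t
        using mult_left_mono[OF that, of "2 * a"] a by (simp add: algebra_simps power2_eq_square)
      with elim show ?case by (auto simp: exp_martingale_def)
    qed
  qed (use E u in \<open>simp_all add: nn_integral_exp_martingale, simp_all add: exp_martingale_def\<close>)
  then show ?thesis
    using exp_minus[of "2 * a * b"] by (simp add: exp_martingale_def inverse_eq_divide)
qed

text \<open>The curve is the equation \<open>mixture_martingale u \<rho> t z = 1 / \<delta>\<close>
  solved for the positive value of \<open>z \<bullet> u\<close>; the martingale starts at 1.\<close>

lemma brownian_mixture_crossing:
  fixes B :: "real \<Rightarrow> 'w \<Rightarrow> 'a::euclidean_space"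
  assumes bm: "brownian_motion M B" and u: "norm u = 1" and \<rho>: "0 < \<rho>"
    and \<delta>: "0 < \<delta>" "\<delta> < 1"
    and E: "E \<in> sets M" "AE \<omega> in M. \<omega> \<in> E \<longrightarrow> (\<exists>t\<ge>0.
      sqrt (2 * (t + \<rho>) * ln (1 / \<delta> * sqrt ((t + \<rho>) / \<rho>))) \<le> B t \<omega> \<bullet> u)"
  shows "measure M E \<le> \<delta>"
proof -
  have "measure M E \<le> mixture_martingale u \<rho> 0 0 / (1 / \<delta>)"
  proof (rule brownian_maximal_inequality[OF bm, where h = "mixture_martingale u \<rho>"])
    show "continuous_on ({0..} \<times> UNIV) (\<lambda>(t, z). mixture_martingale u \<rho> t z)"
      unfolding mixture_martingale_def case_prod_beta using \<rho>
      by (intro continuous_intros) auto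
    show "AE \<omega> in M. \<omega> \<in> E \<longrightarrow> (\<exists>t\<ge>0. 1 / \<delta> \<le> mixture_martingale u \<rho> t (B t \<omega>))"
      using E(2)
    proof eventually_elim
      case (elim \<omega>)
      have "1 / \<delta> \<le> mixture_martingale u \<rho> t z"
        if t: "0 \<le> t" and z: "sqrt (2 * (t + \<rho>) * ln (1 / \<delta> * sqrt ((t + \<rho>) / \<rho>))) \<le> z \<bullet> u" for t z
      proof -
        define c where "c = sqrt ((t + \<rho>) / \<rho>)"
        have c: "1 \<le> c" using t \<rho> by (simp add: c_def)
        have "1 \<le> 1 / \<delta>" using \<delta> by simp
        from mult_mono[OF this c] have "1 \<le> 1 / \<delta> * c" using \<delta> by simp
        then have ln: "0 \<le> ln (1 / \<delta> * c)" by simp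
        then have "2 * (t + \<rho>) * ln (1 / \<delta> * c) \<le> (z \<bullet> u)\<^sup>2"
          using z t \<rho> by (intro sqrt_le_D) (simp add: c_def)
        then have "ln (1 / \<delta> * c) \<le> (z \<bullet> u)\<^sup>2 / (2 * (t + \<rho>))"
          using t \<rho> by (simp add: field_simps)
        then have "1 / \<delta> * c \<le> exp ((z \<bullet> u)\<^sup>2 / (2 * (t + \<rho>)))"
          using \<open>1 \<le> 1 / \<delta> * c\<close> by (metis exp_ln exp_le_cancel_iff less_le_trans zero_less_one)
        then have "1 / \<delta> \<le> exp ((z \<bullet> u)\<^sup>2 / (2 * (t + \<rho>))) / c"
          using c by (simp add: pos_le_divide_eq)
        also have "\<dots> = mixture_martingale u \<rho> t z"
          using t \<rho> by (simp add: mixture_martingale_def c_def real_sqrt_divide)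
        finally show ?thesis .
      qed
      with elim show ?case by auto
    qed
  qed (use E u \<rho> \<delta> in \<open>simp_all add: nn_integral_mixture_martingale, simp_all add: mixture_martingale_def\<close>)
  then show ?thesis using \<rho> by (simp add: mixture_martingale_def)
qed

text \<open>Reduces both boundaries to one crossing problem. With the loss bounded by a function of
  the Brownian motion at \<tau>, a loss of at least \<psi> forces the projection of the path onto a
  unit vector to reach \<open>g\<close> at that time, whatever \<open>n\<close> is.\<close>

lemma privacy_boundaryI:
  fixes M :: "'w measure" and B :: "real \<Rightarrow> 'w \<Rightarrow> 'a::euclidean_space"
  assumes \<Delta>: "0 < \<Delta>" and sens: "l2_sensitivity_le nbr f \<Delta>"
    and T: "time_functions T" and bm: "brownian_motion M B" and \<delta>: "0 < \<delta>"
    and g_pos: "\<And>t. 0 < t \<Longrightarrow> 0 < g t" and [measurable]: "\<psi> \<in> borel_measurable borel"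
    and \<psi>: "\<And>t. 0 < t \<Longrightarrow> \<psi> t = \<Delta>\<^sup>2 / (2 * t) + \<Delta> / t * g t"
    and crossing: "\<And>u E. norm (u :: 'a) = 1 \<Longrightarrow> E \<in> sets M \<Longrightarrow>
      AE \<omega> in M. \<omega> \<in> E \<longrightarrow> (\<exists>t\<ge>0. g t \<le> B t \<omega> \<bullet> u) \<Longrightarrow> measure M E \<le> \<delta>"
  shows "privacy_boundary M B nbr f T \<delta> \<psi>"
  unfolding privacy_boundary_def
proof (intro conjI allI impI)
  show "0 \<le> \<psi> t" if "0 < t" for t
    using \<Delta> that g_pos[OF that] by (simp add: \<psi>[OF that])
next
  fix x x' and L :: "nat \<Rightarrow> 'w \<Rightarrow> ereal"
  assume "nbr x x'"
  then have sens: "norm (f x - f x') \<le> \<Delta>" using sens by (simp add: l2_sensitivity_le_def)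
  assume L: "\<forall>n\<ge>1. privacy_loss M (PiM {1..n} (\<lambda>_. borel))
    (brownian_prefix B T (f x) n) (brownian_prefix B T (f x') n) (L n)"
  define v where "v = f x' - f x"
  define \<tau> where "\<tau> n \<omega> = brownian_time B T (f x) n \<omega>" for n \<omega>
  define E where "E = {\<omega> \<in> space M. \<exists>n\<ge>1. ereal (\<psi> (\<tau> n \<omega>)) \<le> L n \<omega>}"
  have v: "norm v \<le> \<Delta>" using sens by (simp add: v_def norm_minus_commute)
  have E_eq: "E = (\<Union>n\<in>{1..}. {\<omega> \<in> space M. ereal (\<psi> (\<tau> n \<omega>)) \<le> L n \<omega>})"
    by (auto simp: E_def)
  have "{\<omega> \<in> space M. ereal (\<psi> (\<tau> n \<omega>)) \<le> L n \<omega>} \<in> sets M" if n: "1 \<le> n" for n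
  proof -
    have [measurable]: "L n \<in> borel_measurable M" "(\<lambda>\<omega>. \<tau> n \<omega>) \<in> borel_measurable M"
      using L n measurable_brownian_time[OF T bm n] by (auto simp: privacy_loss_def \<tau>_def)
    show ?thesis by measurable
  qed
  then have E: "E \<in> sets M" unfolding E_eq by (intro sets.countable_UN'') auto
  have L_le: "AE \<omega> in M. \<forall>n\<ge>1. L n \<omega> \<le> ereal ((v \<bullet> v / 2 - B (\<tau> n \<omega>) \<omega> \<bullet> v) / \<tau> n \<omega>)"
    unfolding AE_all_countable
  proof
    fix n
    show "AE \<omega> in M. 1 \<le> n \<longrightarrow> L n \<omega> \<le> ereal ((v \<bullet> v / 2 - B (\<tau> n \<omega>) \<omega> \<bullet> v) / \<tau> n \<omega>)"
      using brownian_privacy_loss_le[OF T bm, of n "f x" v "L n"] L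
      by (cases "1 \<le> n") (auto simp: v_def \<tau>_def)
  qed
  have cross: "AE \<omega> in M. \<omega> \<in> E \<longrightarrow> (\<exists>t>0. \<Delta> * g t \<le> - (B t \<omega> \<bullet> v))"
    using L_le
  proof (eventually_elim, intro impI)
    fix \<omega> assume le: "\<forall>n\<ge>1. L n \<omega> \<le> ereal ((v \<bullet> v / 2 - B (\<tau> n \<omega>) \<omega> \<bullet> v) / \<tau> n \<omega>)" and "\<omega> \<in> E"
    then obtain n where n: "1 \<le> n" "ereal (\<psi> (\<tau> n \<omega>)) \<le> L n \<omega>" by (auto simp: E_def)
    define t where "t = \<tau> n \<omega>"
    have t: "0 < t" unfolding t_def \<tau>_def by (rule brownian_time_pos[OF T n(1)])
    have "ereal (\<psi> t) \<le> ereal ((v \<bullet> v / 2 - B t \<omega> \<bullet> v) / t)"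
      using n le unfolding t_def by (blast intro: order_trans)
    then have "(\<Delta>\<^sup>2 / 2 + \<Delta> * g t) / t \<le> (v \<bullet> v / 2 - B t \<omega> \<bullet> v) / t"
      by (simp add: \<psi>[OF t] add_divide_distrib)
    then have "\<Delta>\<^sup>2 / 2 + \<Delta> * g t \<le> v \<bullet> v / 2 - B t \<omega> \<bullet> v"
      using t by (simp add: divide_le_cancel)
    moreover have "v \<bullet> v \<le> \<Delta>\<^sup>2"
      using v by (simp add: dot_square_norm power_mono)
    ultimately show "\<exists>t>0. \<Delta> * g t \<le> - (B t \<omega> \<bullet> v)" using t by (intro exI[of _ t]) auto
  qed
  have "measure M E \<le> \<delta>"
  proof (cases "v = 0")
    \<comment> \<open>A zero shift has no direction; the crossing inequality then contradicts
      positivity of \<open>g\<close>, so \<open>E\<close> is null.\<close>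
    case True
    have no_cross: "\<not> \<Delta> * g t \<le> 0" if "0 < t" for t
      using mult_pos_pos[OF \<Delta> g_pos[OF that]] by linarith
    have "AE \<omega> in M. \<omega> \<in> E \<longleftrightarrow> \<omega> \<in> {}"
      using cross by eventually_elim (use True no_cross in auto)
    then have "emeasure M E = emeasure M {}"
      by (rule emeasure_eq_AE) (use E in auto)
    then show ?thesis using \<delta> by (simp add: measure_def)
  next
    case False
    \<comment> \<open>The loss grows with \<open>- (B t \<omega> \<bullet> v)\<close>, hence the
      sign.\<close>
    define u where "u = - (1 / norm v) *\<^sub>R v"
    show ?thesis
    proof (rule crossing[OF _ E])
      show "norm u = 1" using False by (simp add: u_def)
      show "AE \<omega> in M. \<omega> \<in> E \<longrightarrow> (\<exists>t\<ge>0. g t \<le> B t \<omega> \<bullet> u)"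
        using cross
      proof (eventually_elim, intro impI)
        fix \<omega> assume "\<omega> \<in> E \<longrightarrow> (\<exists>t>0. \<Delta> * g t \<le> - (B t \<omega> \<bullet> v))" "\<omega> \<in> E"
        then obtain t where t: "0 < t" "\<Delta> * g t \<le> - (B t \<omega> \<bullet> v)" by blast
        \<comment> \<open>Positivity of \<open>g\<close> allows the sensitivity bound to be replaced
          by the actual, possibly smaller, distance.\<close>
        have "norm v * g t \<le> \<Delta> * g t"
          using v g_pos[OF t(1)] by (intro mult_right_mono) auto
        with t have "norm v * g t \<le> - (B t \<omega> \<bullet> v)" by linarith
        then have "g t \<le> B t \<omega> \<bullet> u" using False by (simp add: u_def field_simps)
        with t show "\<exists>t\<ge>0. g t \<le> B t \<omega> \<bullet> u" by (intro exI[of _ t]) auto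
      qed
    qed
  qed
  with E show "let E = {\<omega> \<in> space M. \<exists>n\<ge>1. ereal (\<psi> (brownian_time B T (f x) n \<omega>)) \<le> L n \<omega>}
    in E \<in> sets M \<and> measure M E \<le> \<delta>"
    unfolding Let_def E_def \<tau>_def by (rule conjI)
qed

theorem theorem3p6:
  fixes M :: "'w measure"
    and B :: "real \<Rightarrow> 'w \<Rightarrow> 'a::euclidean_space"
    and nbr :: "'x \<Rightarrow> 'x \<Rightarrow> bool"
    and f :: "'x \<Rightarrow> 'a"
    and T :: "nat \<Rightarrow> (nat \<Rightarrow> 'a) \<Rightarrow> real"
    and \<delta> \<Delta> :: real
  assumes "0 < \<delta>" and "\<delta> < 1"
    and "0 < \<Delta>" and "l2_sensitivity_le nbr f \<Delta>"
    and "time_functions T"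
    and "brownian_motion M B"
  shows "(\<forall>\<rho>>0. privacy_boundary M B nbr f T \<delta> (mixture_boundary \<Delta> \<delta> \<rho>)) \<and>
         (\<forall>a>0. \<forall>b>0. 2 * a * b = ln (1 / \<delta>) \<longrightarrow>
            privacy_boundary M B nbr f T \<delta> (linear_boundary \<Delta> a b))"
proof (intro conjI allI impI)
  fix \<rho> :: real assume \<rho>: "0 < \<rho>"
  \<comment> \<open>The curve of the mixture crossing bound: the boundary is the drift term
    \<Delta>^2 / (2 t) plus \<Delta> / t times this curve.\<close>
  define g where "g t = sqrt (2 * (t + \<rho>) * ln (1 / \<delta> * sqrt ((t + \<rho>) / \<rho>)))" for t
  show "privacy_boundary M B nbr f T \<delta> (mixture_boundary \<Delta> \<delta> \<rho>)"
  proof (rule privacy_boundaryI[OF assms(3-6,1), where g = g])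
    show "0 < g t" if "0 < t" for t
    proof -
      have "1 \<le> sqrt ((t + \<rho>) / \<rho>)" using that \<rho> by simp
      moreover have "1 < 1 / \<delta>" using assms(1,2) by simp
      ultimately have "1 < 1 / \<delta> * sqrt ((t + \<rho>) / \<rho>)"
        by (metis less_le_trans mult.right_neutral mult_left_mono order_less_imp_le zero_less_one)
      then show ?thesis using that \<rho> by (simp add: g_def)
    qed
    show "mixture_boundary \<Delta> \<delta> \<rho> \<in> borel_measurable borel"
      unfolding mixture_boundary_def[abs_def] by measurable
    show "measure M E \<le> \<delta>" if "norm (u :: 'a) = 1" "E \<in> sets M"
      "AE \<omega> in M. \<omega> \<in> E \<longrightarrow> (\<exists>t\<ge>0. g t \<le> B t \<omega> \<bullet> u)" for u E
      using brownian_mixture_crossing[OF assms(6) that(1) \<rho> assms(1,2) that(2)] that(3)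
      by (simp add: g_def)
  qed (simp add: mixture_boundary_def g_def)
next
  fix a b :: real assume a: "0 < a" and b: "0 < b" and ab: "2 * a * b = ln (1 / \<delta>)"
  show "privacy_boundary M B nbr f T \<delta> (linear_boundary \<Delta> a b)"
  proof (rule privacy_boundaryI[OF assms(3-6,1), where g = "\<lambda>t. b + a * t"])
    show "linear_boundary \<Delta> a b \<in> borel_measurable borel"
      unfolding linear_boundary_def[abs_def] by measurable
    have "exp (- 2 * a * b) = \<delta>" using ab assms(1) by (simp add: ln_div)
    then show "measure M E \<le> \<delta>" if "norm (u :: 'a) = 1" "E \<in> sets M"
      "AE \<omega> in M. \<omega> \<in> E \<longrightarrow> (\<exists>t\<ge>0. b + a * t \<le> B t \<omega> \<bullet> u)" for u E
      using brownian_linear_crossing[OF assms(6) that(1) a b that(2,3)] by simp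
    show "0 < b + a * t" if "0 < t" for t using a b that by (simp add: add_pos_pos)
    show "linear_boundary \<Delta> a b t = \<Delta>\<^sup>2 / (2 * t) + \<Delta> / t * (b + a * t)" if "0 < t" for t
      using that by (simp add: linear_boundary_def distrib_left power2_eq_square)
  qed
qed

end
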